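(* Let $X\in\mathbb{M}_1$ and $\alpha\in(0,1)$. (i) There exist a function $f:[0,1/\alpha)\to\mathbb{R}$ that is completely monotone on $(0,1/\alpha)$ with $f(0+)=f(0)$ and a set $S\subset(0,\min(\alpha^{-1},2))$ containing an accumulation point (of $S$) such that $f(s)=G_X(s)$ for all $s\in S$, if and only if $X\in\mathbb{M}_\alpha$. In this case there exists $Z\in\mathbb{M}_1$ such that $G_X(s)=G_Z(\alpha s)$ for all $s\in[0,2]$. (ii) There exist a function $f:[0,\infty)\to\mathbb{R}$ that is completely monotone on $(0,\infty)$ with $f(0)=f(0+)$ and a set $S\subset(0,2)$ containing an accumulation point (of $S$) such that $f(s)=G_X(s)$ for all $s\in S$, if and only if $X$ has a mixed Poisson distribution. Equivalently, there exists some nonnegative random variable $Y$ such that $G_X(s)=L_Y(s)$ for all $s\in[0,2]$.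
   Context: Notation. $\mathbb{Z}_+=\{0,1,2,\ldots\}$. $\mathbb{M}_1$ is the family of all probability distributions supported in $\mathbb{Z}_+$; $X\in\mathbb{M}_1$ means that the distribution of the random variable $X$ is in $\mathbb{M}_1$. $\sim$ means equality in distribution. For $X\in\mathbb{M}_1$ and $\alpha\in[0,1]$, $\alpha\circ X$ denotes a random variable distributed as $\sum_{i=1}^X B_i$ (empty sum $=0$), where $B_1,B_2,\ldots$ are i.i.d. with $P(B_i=1)=\alpha=1-P(B_i=0)$, independent of $X$. $\mathbb{M}_\alpha$ is the set of distributions of $\alpha\circ Z$ with $Z\in\mathbb{M}_1$; $X\in\mathbb{M}_\alpha$ means $X\sim\alpha\circ Z$ for some $Z\in\mathbb{M}_1$. The alternate probability generating function of $X\in\mathbb{M}_1$ is $G_X(s)=\sum_{k\ge 0}(1-s)^kP(X=k)$, $s\in[0,2]$ (with $0^0=1$). For a nonnegative random variable $Y$, $L_Y(s)=\mathbb{E}e^{-sY}$. A function $f$ is completely monotone on an open interval if it is infinitely differentiable there and $(-1)^nf^{(n)}(t)\ge0$ for all $n\ge0$ and all $t$ in the interval. $X$ has a mixed Poisson distribution if for some nonnegative random variable $Y$ the conditional distribution of $X$ given $Y$ is Poisson with mean $Y$ (Poisson with mean $0$ is the constant $0$). *)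

theory Defs
  imports "HOL-Probability.Probability" "HOL-Probability.Product_PMF"
begin

text \<open>
  A probability distribution supported in the nonnegative integers is a \<open>nat pmf\<close>.
  Throughout, such a distribution stands for any random variable having it.
\<close>

text \<open>
  The law of \<open>B\<^sub>1 + \<dots> + B\<^sub>X\<close>, where the \<open>B\<^sub>i\<close> are i.i.d. Bernoulli with parameter \<open>\<alpha>\<close>
  and independent of \<open>X\<close>; meant for \<open>0 \<le> \<alpha> \<le> 1\<close>.
\<close>
definition thin :: "real \<Rightarrow> nat pmf \<Rightarrow> nat pmf" where
  "thin \<alpha> X =
     bind_pmf X (\<lambda>n. map_pmf (\<lambda>B. \<Sum>i\<in>{1..n}. of_bool (B i))
                        (Pi_pmf {1..n} False (\<lambda>_. bernoulli_pmf \<alpha>)))"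

definition thinned :: "real \<Rightarrow> nat pmf set" where
  "thinned \<alpha> = {X. \<exists>Z. X = thin \<alpha> Z}"

text \<open>Meant for \<open>0 \<le> s \<le> 2\<close>, where the series converges absolutely; \<open>0 ^ 0 = 1\<close>.\<close>
definition alt_pgf :: "nat pmf \<Rightarrow> real \<Rightarrow> real" where
  "alt_pgf X s = (\<Sum>k. (1 - s) ^ k * pmf X k)"

text \<open>
  Meant for open \<open>I\<close>; then the iterated derivatives at points of \<open>I\<close> depend only on the
  values of \<open>f\<close> on \<open>I\<close>.
\<close>
definition completely_monotone_on :: "real set \<Rightarrow> (real \<Rightarrow> real) \<Rightarrow> bool" where
  "completely_monotone_on I f \<longleftrightarrow>
     (\<forall>n. \<forall>t\<in>I. (deriv ^^ n) f field_differentiable (at t) \<and> (-1) ^ n * (deriv ^^ n) f t \<ge> 0)"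

definition nonneg_rv :: "'a measure \<Rightarrow> ('a \<Rightarrow> real) \<Rightarrow> bool" where
  "nonneg_rv M Y \<longleftrightarrow> prob_space M \<and> Y \<in> borel_measurable M \<and> (\<forall>\<omega>\<in>space M. 0 \<le> Y \<omega>)"

definition laplace :: "'a measure \<Rightarrow> ('a \<Rightarrow> real) \<Rightarrow> real \<Rightarrow> real" where
  "laplace M Y s = (\<integral>\<omega>. exp (- s * Y \<omega>) \<partial>M)"

text \<open>The library's \<open>poisson_pmf\<close> is only specified for positive rates.\<close>
definition poisson0_pmf :: "real \<Rightarrow> nat pmf" where
  "poisson0_pmf r = (if r = 0 then return_pmf 0 else poisson_pmf r)"

text \<open>
  Some random variable \<open>N\<close> with distribution \<open>X\<close> has, given some nonnegative \<open>Y\<close>, the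
  conditional distribution Poisson with mean \<open>Y\<close>: the conditional probability of \<open>N = k\<close> given
  the sigma-algebra generated by \<open>Y\<close> is almost surely the Poisson probability of \<open>k\<close>.
  Fixing the type of the sample points loses nothing, since the space may be replaced by
  the product of the ranges of \<open>Y\<close> and \<open>N\<close>, carrying their joint law.
\<close>
definition mixed_poisson :: "nat pmf \<Rightarrow> bool" where
  "mixed_poisson X \<longleftrightarrow>
     (\<exists>(M :: (real \<times> nat) measure) N Y.
        nonneg_rv M Y \<and>
        N \<in> measurable M (count_space UNIV) \<and>
        distr M (count_space UNIV) N = measure_pmf X \<and>
        (\<forall>k. AE \<omega> in M.
           real_cond_exp M (vimage_algebra (space M) Y borel)
             (indicator {\<omega> \<in> space M. N \<omega> = k}) \<omega> = pmf (poisson0_pmf (Y \<omega>)) k))"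

end

theory Submission
  imports Defs "HOL-Complex_Analysis.Complex_Analysis"
begin

text \<open>
  Write \<open>G\<close> for the alternate generating function. Three facts about it carry both equivalences:
  a law is determined by its \<open>G\<close>; thinning rescales the argument, so that the \<open>G\<close> of
  \<open>\<alpha> \<circ> Z\<close> at \<open>s\<close> is the \<open>G\<close> of \<open>Z\<close> at \<open>\<alpha> s\<close> (lemma \<open>alt_pgf_thin\<close>); and \<open>G(t/c)\<close> is a power
  series in \<open>1 - t/c\<close> with nonnegative coefficients, hence completely monotone on \<open>(0,c)\<close>.

  For thinnings, the easy direction is the combination of the last two facts. Conversely, Bernstein's
  argument (\<open>completely_monotone_power_series\<close>) expands a function \<open>f\<close> completely monotone on
  \<open>(0,c)\<close>, with \<open>c = 1/\<alpha>\<close>, around the right end point: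
  \<open>f(s) = \<Sum> a\<^sub>k (c - s)^k\<close> with \<open>a\<^sub>k \<ge> 0\<close>. This series extends to the complex disc of radius \<open>c\<close>
  around \<open>c\<close>, which contains the disc of radius \<open>1\<close> around \<open>1\<close> on which \<open>G\<close> lives. Analytic
  continuation from \<open>S\<close> therefore gives \<open>G(s) = \<Sum> b\<^sub>k (1 - \<alpha> s)^k\<close> with \<open>b\<^sub>k = a\<^sub>k c^k\<close> on all of
  \<open>[0,2]\<close>. The point \<open>s = 0\<close> shows that the \<open>b\<^sub>k\<close> sum to one, and the law that they form is the
  required \<open>Z\<close>.

  For mixed Poisson laws, integrating the \<open>G\<close> of the Poisson law with mean \<open>Y\<close>, which is
  \<open>exp (- s Y)\<close>, shows that the \<open>G\<close> of a Poisson mixture is the Laplace transform of the mixing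
  variable. Applied to \<open>c Y\<close> this identity presents \<open>L\<^sub>Y(t)\<close>, for \<open>t \<le> 2 c\<close>, as \<open>G(t/c)\<close> for another
  mixture, so that complete monotonicity of Laplace transforms is inherited from that of generating
  functions. Conversely, a function completely monotone on \<open>(0,\<infinity>)\<close> is so on every \<open>(0,1/\<alpha>)\<close>, and the
  first part writes \<open>X\<close> as an \<open>\<alpha>\<close>-thinning of some \<open>Z\<^sub>\<alpha>\<close> for arbitrarily small \<open>\<alpha>\<close>. The laws of
  \<open>\<alpha> Z\<^sub>\<alpha>\<close> are tight, and because \<open>(1 - \<alpha> s)^k\<close> is uniformly close to \<open>exp (- s \<alpha> k)\<close>, the Laplace
  transform of any weak limit of them is \<open>G\<close> (\<open>laplace_if_thinned_arbitrarily\<close>).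
\<close>

section \<open>Bernstein's power series of a completely monotone function\<close>

text \<open>
  The signed derivatives \<open>D k = (-1)^k f^(k)\<close> turn complete monotonicity into nonnegativity together
  with the relation \<open>D k' = - D (Suc k)\<close>. The Taylor estimates below use only these two properties.
\<close>
lemma signed_derivatives:
  assumes "completely_monotone_on {0<..<c} f" "t \<in> {0<..<c}"
  shows "(-1) ^ k * (deriv ^^ k) f t \<ge> 0"
    and "((\<lambda>t. (-1) ^ k * (deriv ^^ k) f t) has_real_derivative - ((-1) ^ Suc k * (deriv ^^ Suc k) f t)) (at t)"
proof -
  show "(-1) ^ k * (deriv ^^ k) f t \<ge> 0"
    using assms by (auto simp: completely_monotone_on_def)
  have "((deriv ^^ k) f has_real_derivative deriv ((deriv ^^ k) f) t) (at t)"
    using assms by (auto simp: completely_monotone_on_def field_differentiable_derivI)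
  from DERIV_cmult[OF this, of "(-1) ^ k"]
  show "((\<lambda>t. (-1) ^ k * (deriv ^^ k) f t) has_real_derivative - ((-1) ^ Suc k * (deriv ^^ Suc k) f t)) (at t)"
    by simp
qed

text \<open>
  The sum is the Taylor polynomial at \<open>s\<close> of the expansion of \<open>D 0\<close> around \<open>t\<close>. As a function of the
  centre \<open>t\<close> its derivative telescopes to a single term.
\<close>
lemma has_derivative_taylor_sum:
  fixes D :: "nat \<Rightarrow> real \<Rightarrow> real"
  assumes "\<And>k. (D k has_real_derivative - D (Suc k) t) (at t)"
  shows "((\<lambda>t. \<Sum>k<Suc n. D k t * (t - s) ^ k / fact k)
           has_real_derivative - (D (Suc n) t * (t - s) ^ n / fact n)) (at t)"
proof (induction n)
  case 0
  show ?case using assms[of 0] by simp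
next
  case (Suc n)
  have "((\<lambda>t. D (Suc n) t * (t - s) ^ Suc n / fact (Suc n)) has_real_derivative
          (- D (Suc (Suc n)) t * (t - s) ^ Suc n + real (Suc n) * (t - s) ^ n * D (Suc n) t) / fact (Suc n)) (at t)"
    by (auto intro!: derivative_eq_intros assms simp del: power_Suc)
  also have "(- D (Suc (Suc n)) t * (t - s) ^ Suc n + real (Suc n) * (t - s) ^ n * D (Suc n) t) / fact (Suc n)
     = D (Suc n) t * (t - s) ^ n / fact n - D (Suc (Suc n)) t * (t - s) ^ Suc n / fact (Suc n)"
    by (simp add: field_simps del: of_nat_Suc power_Suc)
  finally show ?case
    using DERIV_add[OF Suc] by (force simp del: power_Suc fact_Suc)
qed

text \<open>
  The mean value theorem applied to the centre of expansion gives the remainder in Cauchy's form.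
  Lagrange's form would control the remainder only for \<open>s\<close> near \<open>b\<close>.
\<close>
lemma taylor_mean_value:
  fixes D :: "nat \<Rightarrow> real \<Rightarrow> real"
  assumes der: "\<And>k t. t \<in> {0<..<c} \<Longrightarrow> (D k has_real_derivative - D (Suc k) t) (at t)"
    and "0 < s" "s < b" "b < c"
  obtains \<xi> where "s < \<xi>" "\<xi> < b"
    "D 0 s = (\<Sum>k<Suc n. D k b * (b - s) ^ k / fact k) + (b - s) * (D (Suc n) \<xi> * (\<xi> - s) ^ n / fact n)"
proof -
  let ?g = "\<lambda>t. \<Sum>k<Suc n. D k t * (t - s) ^ k / fact k"
  have "\<exists>z>s. z < b \<and> ?g b - ?g s = (b - s) * - (D (Suc n) z * (z - s) ^ n / fact n)"
    by (rule MVT2) (use assms in \<open>auto intro!: has_derivative_taylor_sum simp del: sum.lessThan_Suc\<close>)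
  moreover have "?g s = D 0 s"
    by (subst sum.lessThan_Suc_shift) simp
  ultimately show ?thesis
    using that by (auto simp del: sum.lessThan_Suc)
qed

text \<open>
  Every Taylor term and the remainder are nonnegative, so each term is at most the value of the
  function. This is a bound on \<open>D k b\<close> in terms of values of the function to the left of \<open>b\<close>.
\<close>
lemma taylor_term_le:
  fixes D :: "nat \<Rightarrow> real \<Rightarrow> real"
  assumes nonneg: "\<And>k t. t \<in> {0<..<c} \<Longrightarrow> 0 \<le> D k t"
    and der: "\<And>k t. t \<in> {0<..<c} \<Longrightarrow> (D k has_real_derivative - D (Suc k) t) (at t)"
    and s: "0 < s" "s < b" "b < c"
  shows "D k b * (b - s) ^ k / fact k \<le> D 0 s"
proof -
  obtain \<xi> where "s < \<xi>" "\<xi> < b"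
    and eq: "D 0 s = (\<Sum>j<Suc k. D j b * (b - s) ^ j / fact j) + (b - s) * (D (Suc k) \<xi> * (\<xi> - s) ^ k / fact k)"
    using taylor_mean_value[where D = D and c = c, OF der s] by blast
  have "D k b * (b - s) ^ k / fact k \<le> (\<Sum>j<Suc k. D j b * (b - s) ^ j / fact j)"
    by (rule member_le_sum) (use s nonneg in auto)
  moreover have "0 \<le> (b - s) * (D (Suc k) \<xi> * (\<xi> - s) ^ k / fact k)"
    using s nonneg[of \<xi> "Suc k"] \<open>s < \<xi>\<close> \<open>\<xi> < b\<close> by simp
  ultimately show ?thesis using eq by linarith
qed

text \<open>
  Bernstein's estimate: the derivative in Cauchy's remainder is controlled by the value at a point \<open>r\<close>
  further to the left, at the price of the geometric factor \<open>((c - s) / (c - r))^n\<close>. The bound does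
  not depend on the centre \<open>b\<close>, so it survives the passage to the end point \<open>c\<close>.
\<close>
lemma taylor_remainder_bound:
  fixes D :: "nat \<Rightarrow> real \<Rightarrow> real"
  assumes nonneg: "\<And>k t. t \<in> {0<..<c} \<Longrightarrow> 0 \<le> D k t"
    and der: "\<And>k t. t \<in> {0<..<c} \<Longrightarrow> (D k has_real_derivative - D (Suc k) t) (at t)"
    and s: "0 < r" "r < s" "s < b" "b < c"
  shows "\<bar>D 0 s - (\<Sum>k<Suc n. D k b * (b - s) ^ k / fact k)\<bar>
      \<le> (c - s) / (s - r) * D 0 r * (real (Suc n) * ((c - s) / (c - r)) ^ n)"
proof -
  obtain \<xi> where \<xi>: "s < \<xi>" "\<xi> < b"
    and eq: "D 0 s = (\<Sum>j<Suc n. D j b * (b - s) ^ j / fact j) + (b - s) * (D (Suc n) \<xi> * (\<xi> - s) ^ n / fact n)"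
    using taylor_mean_value[where D = D and c = c and s = s and b = b and n = n, OF der] s
    by (metis (no_types, lifting) order.strict_trans)
  have pos: "0 < \<xi> - r" "0 < s - r" "0 < c - r" "0 < \<xi> - s" "0 < c - s" "0 \<le> D (Suc n) \<xi>" "0 \<le> D 0 r"
    using \<xi> s nonneg[of \<xi> "Suc n"] nonneg[of r 0] by auto
  have "D (Suc n) \<xi> * (\<xi> - r) ^ Suc n / fact (Suc n) \<le> D 0 r"
    using taylor_term_le[where D = D and c = c and s = r and b = \<xi> and k = "Suc n", OF nonneg der] \<xi> s by auto
  \<comment> \<open>dividing by \<open>fact n\<close> instead of \<open>fact (Suc n)\<close> costs the harmless factor \<open>Suc n\<close>\<close>
  then have D: "D (Suc n) \<xi> / fact n \<le> real (Suc n) * D 0 r / (\<xi> - r) ^ Suc n"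
    using pos by (simp add: field_simps del: power_Suc of_nat_Suc)
  have "(\<xi> - s) * (c - r) \<le> (c - s) * (\<xi> - r)"
  proof -
    have "(c - s) * (\<xi> - r) - (\<xi> - s) * (c - r) = (c - \<xi>) * (s - r)" by algebra
    also have "\<dots> \<ge> 0" using \<xi> s by simp
    finally show ?thesis by simp
  qed
  then have q: "(\<xi> - s) / (\<xi> - r) \<le> (c - s) / (c - r)"
    using pos by (simp add: field_simps)
  have "(b - s) * (D (Suc n) \<xi> * (\<xi> - s) ^ n / fact n) = (b - s) * (\<xi> - s) ^ n * (D (Suc n) \<xi> / fact n)"
    by simp
  also have "\<dots> \<le> (b - s) * (\<xi> - s) ^ n * (real (Suc n) * D 0 r / (\<xi> - r) ^ Suc n)"
    by (rule mult_left_mono[OF D]) (use \<xi> in simp)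
  also have "\<dots> = ((b - s) / (\<xi> - r)) * D 0 r * (real (Suc n) * ((\<xi> - s) / (\<xi> - r)) ^ n)"
    by (simp add: power_divide del: of_nat_Suc)
  also have "\<dots> \<le> ((c - s) / (s - r)) * D 0 r * (real (Suc n) * ((c - s) / (c - r)) ^ n)"
    by (intro mult_mono power_mono q frac_le mult_nonneg_nonneg) (use pos \<xi> s in auto)
  finally have "(b - s) * (D (Suc n) \<xi> * (\<xi> - s) ^ n / fact n) \<le> \<dots>" .
  moreover have "0 \<le> (b - s) * (D (Suc n) \<xi> * (\<xi> - s) ^ n / fact n)"
    using pos \<xi> by simp
  ultimately show ?thesis using eq by linarith
qed

text \<open>
  As \<open>b\<close> increases to \<open>c\<close>, each \<open>D k b\<close> decreases to its infimum, which is nonnegative. These limits,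
  divided by \<open>k!\<close>, are the coefficients at \<open>c\<close>, and the remainder bound passes to the limit.
\<close>
theorem completely_monotone_power_series:
  assumes cm: "completely_monotone_on {0<..<c} f" and "0 < c"
  obtains a :: "nat \<Rightarrow> real" where "\<And>k. 0 \<le> a k"
    and "\<And>s. s \<in> {0<..<c} \<Longrightarrow> (\<lambda>k. a k * (c - s) ^ k) sums f s"
proof -
  define D where "D k t = (-1) ^ k * (deriv ^^ k) f t" for k t
  have nonneg: "0 \<le> D k t" and der: "(D k has_real_derivative - D (Suc k) t) (at t)"
    if "t \<in> {0<..<c}" for k t
    using signed_derivatives[OF cm that, of k] unfolding D_def by auto
  have mono: "D k b \<le> D k a" if "0 < a" "a \<le> b" "b < c" for k a b
  proof (rule DERIV_nonpos_imp_nonincreasing[OF that(2)])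
    fix t assume "a \<le> t" "t \<le> b"
    then show "\<exists>y. (D k has_real_derivative y) (at t) \<and> y \<le> 0"
      using der[of t k] nonneg[of t "Suc k"] that by auto
  qed
  define L where "L k = Inf (D k ` {0<..<c})" for k
  have L: "(D k \<longlongrightarrow> L k) (at_left c)" for k
  proof (rule tendstoI)
    fix e :: real assume "0 < e"
    have bdd: "bdd_below (D k ` {0<..<c})" using nonneg by (auto intro!: bdd_belowI[of _ 0])
    moreover have "D k ` {0<..<c} \<noteq> {}" using \<open>0 < c\<close> by simp
    ultimately obtain a where a: "a \<in> {0<..<c}" "D k a < L k + e"
      using cInf_lessD[of "D k ` {0<..<c}" "L k + e"] \<open>0 < e\<close> unfolding L_def by auto
    have "eventually (\<lambda>b. b \<in> {a<..<c}) (at_left c)"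
      using a by (intro eventually_at_leftI[of a]) auto
    then show "eventually (\<lambda>b. dist (D k b) (L k) < e) (at_left c)"
    proof eventually_elim
      case (elim b)
      have "L k \<le> D k b" unfolding L_def by (rule cInf_lower) (use elim a bdd in auto)
      moreover have "D k b \<le> D k a" using mono[of a b k] elim a by auto
      ultimately show ?case using a by (auto simp: dist_real_def)
    qed
  qed
  have L0: "0 \<le> L k" for k
    unfolding L_def using \<open>0 < c\<close> nonneg by (intro cInf_greatest) auto
  show ?thesis
  proof (rule that[of "\<lambda>k. L k / fact k"])
    show "0 \<le> L k / fact k" for k using L0 by simp
    fix s assume s: "s \<in> {0<..<c}"
    \<comment> \<open>any point strictly between \<open>0\<close> and \<open>s\<close> would serve as the reference point of the estimate\<close>
    define r where "r = s / 2"
    define q where "q = (c - s) / (c - r)"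
    define C where "C = (c - s) / (s - r) * D 0 r"
    have r: "0 < r" "r < s" using s by (auto simp: r_def)
    have q: "0 \<le> q" "q < 1" using s r by (auto simp: q_def)
    have bound: "\<bar>D 0 s - (\<Sum>k<Suc n. L k * (c - s) ^ k / fact k)\<bar> \<le> C * (real (Suc n) * q ^ n)" for n
    proof (rule tendsto_upperbound)
      show "((\<lambda>b. \<bar>D 0 s - (\<Sum>k<Suc n. D k b * (b - s) ^ k / fact k)\<bar>) \<longlongrightarrow>
             \<bar>D 0 s - (\<Sum>k<Suc n. L k * (c - s) ^ k / fact k)\<bar>) (at_left c)"
        by (intro tendsto_intros L) simp
      have "eventually (\<lambda>b. b \<in> {s<..<c}) (at_left c)"
        using s by (intro eventually_at_leftI[of s]) auto
      then show "eventually (\<lambda>b. \<bar>D 0 s - (\<Sum>k<Suc n. D k b * (b - s) ^ k / fact k)\<bar>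
                  \<le> C * (real (Suc n) * q ^ n)) (at_left c)"
      proof eventually_elim
        case (elim b)
        then show ?case unfolding C_def q_def
          by (intro taylor_remainder_bound nonneg der r) auto
      qed
    qed simp
    have "(\<lambda>n. C * (real (Suc n) * q ^ n)) \<longlonglongrightarrow> C * 0"
    proof (intro tendsto_intros)
      have "(\<lambda>n. real n * q ^ n + q ^ n) \<longlonglongrightarrow> 0 + 0"
        using q by (intro tendsto_add powser_times_n_limit_0 LIMSEQ_power_zero) auto
      then show "(\<lambda>n. real (Suc n) * q ^ n) \<longlonglongrightarrow> 0"
        by (simp add: algebra_simps)
    qed
    then have "(\<lambda>n. C * (real (Suc n) * q ^ n)) \<longlonglongrightarrow> 0" by simp
    then have "(\<lambda>n. (\<Sum>k<Suc n. L k * (c - s) ^ k / fact k) - D 0 s) \<longlonglongrightarrow> 0"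
      by (rule Lim_null_comparison[rotated]) (use bound in \<open>auto simp: abs_minus_commute simp del: sum.lessThan_Suc\<close>)
    then have "(\<lambda>n. \<Sum>k<Suc n. L k * (c - s) ^ k / fact k) \<longlonglongrightarrow> D 0 s"
      by (simp add: LIM_zero_iff del: sum.lessThan_Suc)
    then have "(\<lambda>n. \<Sum>k<n. L k * (c - s) ^ k / fact k) \<longlonglongrightarrow> D 0 s"
      by (rule LIMSEQ_imp_Suc)
    then show "(\<lambda>k. L k / fact k * (c - s) ^ k) sums f s"
      by (simp add: sums_def D_def)
  qed
qed

section \<open>Power series with nonnegative summable coefficients\<close>

definition gen_fun :: "(nat \<Rightarrow> real) \<Rightarrow> real \<Rightarrow> real" where
  "gen_fun a x = (\<Sum>k. a k * x ^ k)"

lemma summable_power_series_unit: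
  fixes z :: "'a::{real_normed_field,banach}"
  assumes a: "\<And>k. 0 \<le> a k" "summable (a :: nat \<Rightarrow> real)" and "norm z \<le> 1"
  shows "summable (\<lambda>k. of_real (a k) * z ^ k)"
  by (rule summable_comparison_test'[OF a(2)])
     (use assms in \<open>auto simp: norm_mult norm_power intro!: mult_right_le_one_le power_le_one\<close>)

lemma gen_fun_sums:
  assumes a: "\<And>k. 0 \<le> a k" "summable a" and "\<bar>x\<bar> \<le> 1"
  shows "(\<lambda>k. a k * x ^ k) sums gen_fun a x"
  unfolding gen_fun_def using summable_power_series_unit[of a x, OF a] assms(3)
  by (intro summable_sums) simp

lemma continuous_on_gen_fun:
  assumes a: "\<And>k. 0 \<le> a k" "summable a"
  shows "continuous_on {-1..1} (gen_fun a)"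
proof -
  have "uniform_limit {-1..1} (\<lambda>n x. \<Sum>k<n. a k * x ^ k) (\<lambda>x. \<Sum>k. a k * x ^ k) sequentially"
    by (rule Weierstrass_m_test[OF _ a(2)])
       (use a in \<open>auto simp: abs_mult power_abs intro!: mult_right_le_one_le power_le_one\<close>)
  then show ?thesis
    unfolding gen_fun_def[abs_def]
    by (rule uniform_limit_theorem[rotated]) (auto intro!: always_eventually continuous_intros)
qed

text \<open>
  Partial sums at \<open>x < 1\<close> are at most \<open>B\<close> because the coefficients are nonnegative; letting \<open>x\<close> tend
  to \<open>1\<close> bounds the partial sums of the coefficients.
\<close>
lemma summable_coefficients_if_bounded:
  fixes a :: "nat \<Rightarrow> real"
  assumes a: "\<And>k. 0 \<le> a k"
    and series: "\<And>x. x \<in> {0<..<1} \<Longrightarrow> summable (\<lambda>k. a k * x ^ k)"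
    and bound: "eventually (\<lambda>x. (\<Sum>k. a k * x ^ k) \<le> B) (at_left 1)"
  shows "summable a"
proof (rule bounded_imp_summable[OF a])
  fix n
  have ev: "eventually (\<lambda>x. x \<in> {0<..<1::real}) (at_left 1)"
    by (intro eventually_at_leftI[of 0]) auto
  have "(\<Sum>k\<le>n. a k * 1 ^ k) \<le> B"
  proof (rule tendsto_upperbound)
    show "((\<lambda>x. \<Sum>k\<le>n. a k * x ^ k) \<longlongrightarrow> (\<Sum>k\<le>n. a k * 1 ^ k)) (at_left 1)"
      by (intro tendsto_intros)
    show "eventually (\<lambda>x. (\<Sum>k\<le>n. a k * x ^ k) \<le> B) (at_left 1)"
      using ev bound
    proof eventually_elim
      case (elim x)
      have "(\<Sum>k\<le>n. a k * x ^ k) \<le> (\<Sum>k. a k * x ^ k)"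
        by (rule sum_le_suminf) (use elim series a in auto)
      then show ?case using elim by simp
    qed
  qed simp
  then show "(\<Sum>k\<le>n. a k) \<le> B" by simp
qed

text \<open>
  Each derivative of the series in \<open>1 - t/c\<close> is the series of the formally differentiated
  coefficients, which stay nonnegative, times a power of the inner derivative \<open>- 1/c\<close>.
\<close>
lemma completely_monotone_gen_fun:
  assumes a: "\<And>k. 0 \<le> a k" "summable a" and "0 < c"
  shows "completely_monotone_on {0<..<c} (\<lambda>t. gen_fun a (1 - t / c))"
proof -
  let ?A = "\<lambda>n. (diffs ^^ n) a"
  have summ: "summable (\<lambda>k. ?A n k * x ^ k)" if "norm x < 1" for n and x :: real
    using that
  proof (induction n arbitrary: x)
    case 0
    then show ?case using gen_fun_sums[OF a, of x] by (auto simp: sums_iff)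
  next
    case (Suc n)
    show ?case using termdiff_converges[of x 1 "?A n"] Suc by simp
  qed
  have nonneg: "0 \<le> ?A n k" for n k
    by (induction n arbitrary: k) (auto simp: a diffs_def)
  have inner: "\<bar>1 - t / c\<bar> < 1" if "t \<in> {0<..<c}" for t
    using that \<open>0 < c\<close> by (auto simp: field_simps)
  have der: "((\<lambda>t. (- 1 / c) ^ n * gen_fun (?A n) (1 - t / c)) has_real_derivative
        (- 1 / c) ^ Suc n * gen_fun (?A (Suc n)) (1 - t / c)) (at t)" if "t \<in> {0<..<c}" for n t
  proof -
    have "((\<lambda>x. gen_fun (?A n) x) has_real_derivative gen_fun (?A (Suc n)) (1 - t / c)) (at (1 - t / c))"
      using termdiffs_strong'[of 1 "?A n" "1 - t / c"] summ inner[OF that]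
      by (simp add: gen_fun_def)
    moreover have "((\<lambda>t. 1 - t / c) has_real_derivative - 1 / c) (at t)"
      using \<open>0 < c\<close> by (auto intro!: derivative_eq_intros)
    ultimately
    have "((\<lambda>t. gen_fun (?A n) (1 - t / c)) has_real_derivative
            gen_fun (?A (Suc n)) (1 - t / c) * (- 1 / c)) (at t)"
      by (rule DERIV_chain2[where f = "gen_fun (?A n)" and g = "\<lambda>t. 1 - t / c"])
    from DERIV_cmult[OF this, of "(- 1 / c) ^ n"] show ?thesis
      by (simp add: mult_ac)
  qed
  have deriv: "(deriv ^^ n) (\<lambda>t. gen_fun a (1 - t / c)) t = (- 1 / c) ^ n * gen_fun (?A n) (1 - t / c)"
    and has_der: "((deriv ^^ n) (\<lambda>t. gen_fun a (1 - t / c)) has_real_derivative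
        (- 1 / c) ^ Suc n * gen_fun (?A (Suc n)) (1 - t / c)) (at t)"
    if "t \<in> {0<..<c}" for n t
    using that
  proof (induction n arbitrary: t)
    case 0
    { case 1 then show ?case by simp }
    { case 2 then show ?case using der[of t 0] by simp }
  next
    case (Suc n)
    have eq: "(deriv ^^ Suc n) (\<lambda>t. gen_fun a (1 - t / c)) t =
        (- 1 / c) ^ Suc n * gen_fun (?A (Suc n)) (1 - t / c)" if "t \<in> {0<..<c}" for t
      using DERIV_imp_deriv[OF Suc(2)[OF that]] by simp
    { case 1 then show ?case by (rule eq) }
    { case 2 then show ?case
        by (intro has_field_derivative_transform_within_open[OF der[of t "Suc n"], of "{0<..<c}"])
           (auto simp: eq simp del: funpow.simps) }
  qed
  have "0 \<le> (-1) ^ n * (deriv ^^ n) (\<lambda>t. gen_fun a (1 - t / c)) t" if "t \<in> {0<..<c}" for n t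
  proof -
    have "0 \<le> gen_fun (?A n) (1 - t / c)"
      unfolding gen_fun_def
      by (rule suminf_nonneg[OF summ]) (use inner[OF that] that \<open>0 < c\<close> nonneg in auto)
    moreover have "(-1) ^ n * ((- 1 / c) ^ n) = (1 / c) ^ n"
      by (simp add: power_mult_distrib[symmetric])
    ultimately show ?thesis
      unfolding deriv[OF that] mult.assoc[symmetric] using \<open>0 < c\<close> by simp
  qed
  moreover have "(deriv ^^ n) (\<lambda>t. gen_fun a (1 - t / c)) field_differentiable (at t)"
    if "t \<in> {0<..<c}" for n t
    using has_der[OF that] by (auto simp: field_differentiable_def)
  ultimately show ?thesis by (auto simp: completely_monotone_on_def)
qed

text \<open>
  The identity theorem is applied to complex extensions, for which holomorphy on the connected disc
  \<open>ball 1 1\<close> provides unique continuation.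
\<close>
definition complex_gen_fun :: "(nat \<Rightarrow> real) \<Rightarrow> complex \<Rightarrow> complex" where
  "complex_gen_fun a z = (\<Sum>k. of_real (a k) * z ^ k)"

lemma complex_gen_fun_of_real:
  assumes "\<And>k. 0 \<le> a k" "summable a" "\<bar>x\<bar> \<le> 1"
  shows "complex_gen_fun a (of_real x) = of_real (gen_fun a x)"
proof -
  have "(\<lambda>k. complex_of_real (a k * x ^ k)) sums of_real (gen_fun a x)"
    using gen_fun_sums[OF assms] by (rule sums_of_real)
  then show ?thesis by (simp add: complex_gen_fun_def sums_iff)
qed

lemma holomorphic_complex_gen_fun:
  assumes a: "\<And>k. 0 \<le> a k" "summable a"
  shows "complex_gen_fun a holomorphic_on ball 0 1"
proof (rule power_series_holomorphic)
  fix w :: complex assume "w \<in> ball 0 1"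
  then show "(\<lambda>k. of_real (a k) * (w - 0) ^ k) sums complex_gen_fun a w"
    using summable_power_series_unit[of a w] a by (auto simp: complex_gen_fun_def intro!: summable_sums)
qed

text \<open>
  For \<open>\<alpha> \<le> 1\<close> the point \<open>1 - \<alpha> z\<close> is a convex combination of \<open>1\<close> and \<open>1 - z\<close>, so it stays in the unit
  disc.
\<close>
lemma holomorphic_complex_gen_fun_affine:
  assumes a: "\<And>k. 0 \<le> a k" "summable a" and \<alpha>: "0 < \<alpha>" "\<alpha> \<le> 1"
  shows "(\<lambda>z. complex_gen_fun a (1 - of_real \<alpha> * z)) holomorphic_on ball 1 1"
proof -
  have "1 - of_real \<alpha> * z \<in> ball 0 1" if "z \<in> ball 1 1" for z :: complex
  proof -
    have "1 - of_real \<alpha> * z = of_real (1 - \<alpha>) + of_real \<alpha> * (1 - z)"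
      by (simp add: algebra_simps)
    then have "cmod (1 - of_real \<alpha> * z) \<le> cmod (of_real (1 - \<alpha>)) + cmod (of_real \<alpha> * (1 - z))"
      by (metis norm_triangle_ineq)
    also have "\<dots> = (1 - \<alpha>) + \<alpha> * cmod (1 - z)"
      using \<alpha> by (simp add: norm_mult del: of_real_diff)
    also have "\<dots> < (1 - \<alpha>) + \<alpha> * 1"
      using that \<alpha> by (intro add_strict_left_mono mult_strict_left_mono) (auto simp: dist_norm)
    finally show ?thesis by simp
  qed
  then have "(complex_gen_fun a \<circ> (\<lambda>z. 1 - of_real \<alpha> * z)) holomorphic_on ball 1 1"
    by (intro holomorphic_on_compose_gen[OF _ holomorphic_complex_gen_fun[OF a]] holomorphic_intros) auto
  then show ?thesis by (simp add: o_def)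
qed

lemma complex_gen_fun_identity:
  assumes a: "\<And>k. 0 \<le> a k" "summable a" and b: "\<And>k. 0 \<le> b k" "summable b"
    and \<alpha>: "0 < \<alpha>" "\<alpha> \<le> 1"
    and S: "S \<subseteq> {0<..<2}" "x \<in> S" "x islimpt S"
    and eq: "\<And>s. s \<in> S \<Longrightarrow> gen_fun a (1 - \<alpha> * s) = gen_fun b (1 - s)"
    and z: "z \<in> ball 1 1"
  shows "complex_gen_fun a (1 - of_real \<alpha> * z) = complex_gen_fun b (1 - z)"
proof -
  define F where "F = (\<lambda>z. complex_gen_fun a (1 - of_real \<alpha> * z) - complex_gen_fun b (1 - of_real 1 * z))"
  have "F z = 0"
  proof (rule analytic_continuation[of F "ball 1 1" "complex_of_real ` S" "complex_of_real x" z])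
    show "F holomorphic_on ball 1 1"
      unfolding F_def using a b \<alpha>
      by (intro holomorphic_on_diff holomorphic_complex_gen_fun_affine) auto
    show sub: "complex_of_real ` S \<subseteq> ball 1 1"
    proof clarify
      fix s assume "s \<in> S"
      then have "0 < s" "s < 2" using S(1) by auto
      then have "\<bar>1 - s\<bar> < 1" by auto
      then show "complex_of_real s \<in> ball 1 1"
        by (metis dist_norm mem_ball norm_of_real of_real_1 of_real_diff)
    qed
    show "complex_of_real x \<in> ball 1 1" using sub S by blast
    show "complex_of_real x islimpt complex_of_real ` S"
    proof -
      obtain g where "\<And>n. g n \<in> S - {x}" "g \<longlonglongrightarrow> x"
        using S(3) unfolding islimpt_sequential by blast
      then show ?thesis
        unfolding islimpt_sequential
        by (intro exI[of _ "\<lambda>n. complex_of_real (g n)"]) (auto intro: tendsto_of_real)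
    qed
    show "F w = 0" if "w \<in> complex_of_real ` S" for w
    proof -
      from that obtain s where s: "s \<in> S" "w = of_real s" by blast
      have "0 < s" "s < 2" using S(1) s by auto
      moreover have "\<alpha> * s \<le> 1 * s" "0 < \<alpha> * s"
        using \<alpha> \<open>0 < s\<close> by simp_all
      ultimately have "\<bar>1 - \<alpha> * s\<bar> \<le> 1" "\<bar>1 - s\<bar> \<le> 1" by auto
      then show ?thesis
        using complex_gen_fun_of_real[OF a, of "1 - \<alpha> * s"] complex_gen_fun_of_real[OF b, of "1 - s"] eq[OF s(1)]
        by (simp add: F_def s(2))
    qed
  qed (use z in auto)
  then show ?thesis by (simp add: F_def)
qed

text \<open>
  Analytic continuation reaches the open interval; continuity of both series up to the boundary of
  the unit disc adds the end points \<open>0\<close> and \<open>2\<close>. The value at \<open>0\<close> compares the total masses.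
\<close>
lemma gen_fun_identity:
  assumes a: "\<And>k. 0 \<le> a k" "summable a" and b: "\<And>k. 0 \<le> b k" "summable b"
    and \<alpha>: "0 < \<alpha>" "\<alpha> \<le> 1"
    and S: "S \<subseteq> {0<..<2}" "x \<in> S" "x islimpt S"
    and eq: "\<And>s. s \<in> S \<Longrightarrow> gen_fun a (1 - \<alpha> * s) = gen_fun b (1 - s)"
    and s: "s \<in> {0..2}"
  shows "gen_fun a (1 - \<alpha> * s) = gen_fun b (1 - s)"
proof -
  define F where "F = (\<lambda>s. gen_fun a (1 - \<alpha> * s) - gen_fun b (1 - s))"
  have img: "1 - \<alpha> * s \<in> {-1..1}" if "s \<in> {0..2}" for s
    using that \<alpha> mult_right_mono[of \<alpha> 1 s] by auto
  have zero: "F s = 0" if "s \<in> {0<..<2}" for s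
  proof -
    have "\<bar>1 - s\<bar> < 1" using that by (auto simp: abs_less_iff)
    then have "complex_of_real s \<in> ball 1 1"
      by (metis dist_norm mem_ball norm_of_real of_real_1 of_real_diff)
    from complex_gen_fun_identity[OF a b \<alpha> S eq this]
    have "complex_of_real (gen_fun a (1 - \<alpha> * s)) = of_real (gen_fun b (1 - s))"
      using complex_gen_fun_of_real[OF a, of "1 - \<alpha> * s"] complex_gen_fun_of_real[OF b, of "1 - s"] img[of s] that
      by (simp add: abs_le_iff)
    then show ?thesis by (simp add: F_def)
  qed
  have cont: "continuous_on (closure {0<..<2}) F"
    unfolding F_def using img
    by (intro continuous_on_diff continuous_on_compose2[OF continuous_on_gen_fun[OF a]]
              continuous_on_compose2[OF continuous_on_gen_fun[OF b]] continuous_intros) auto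
  have "F s = 0"
    by (rule continuous_constant_on_closure[OF cont zero]) (use s in auto)
  then show ?thesis by (simp add: F_def)
qed

lemma gen_fun_coefficients_unique:
  assumes a: "\<And>k. 0 \<le> a k" "summable a" and b: "\<And>k. 0 \<le> b k" "summable b"
    and eq: "\<And>s. s \<in> {0<..<2} \<Longrightarrow> gen_fun a (1 - s) = gen_fun b (1 - s)"
  shows "a = b"
proof -
  have eq': "complex_gen_fun a w = complex_gen_fun b w" if "w \<in> ball 0 1" for w
    using complex_gen_fun_identity[OF a b, of 1 "{0<..<2}" 1 "1 - w"] that eq
    by (simp add: dist_norm interior_limit_point)
  have radius: "fps_conv_radius (Abs_fps (\<lambda>k. complex_of_real (c k))) > 0"
    if c: "\<And>k. 0 \<le> c k" "summable c" for c
  proof -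
    have "summable (\<lambda>k. complex_of_real (c k) * 1 ^ k)"
      by (rule summable_power_series_unit[OF c]) simp
    then have "conv_radius (\<lambda>k. complex_of_real (c k)) \<ge> norm (1 :: complex)"
      by (rule conv_radius_geI)
    then have "0 < conv_radius (\<lambda>k. complex_of_real (c k))"
      by (rule less_le_trans[rotated]) simp
    then show ?thesis by (simp add: fps_conv_radius_def)
  qed
  have "Abs_fps (\<lambda>k. complex_of_real (a k)) = Abs_fps (\<lambda>k. complex_of_real (b k))"
  proof (rule eval_fps_eqD[OF radius[OF a] radius[OF b]])
    have "eventually (\<lambda>w :: complex. w \<in> ball 0 1) (nhds 0)"
      by (intro eventually_nhds_in_open) auto
    then show "eventually (\<lambda>w. eval_fps (Abs_fps (\<lambda>k. complex_of_real (a k))) w =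
                 eval_fps (Abs_fps (\<lambda>k. complex_of_real (b k))) w) (nhds 0)"
      by eventually_elim (use eq' in \<open>simp add: eval_fps_def complex_gen_fun_def\<close>)
  qed
  then show ?thesis by (auto simp: fps_eq_iff)
qed

section \<open>Generating functions and thinning\<close>

lemma pmf_nat_sums_1: "pmf (X :: nat pmf) sums 1"
  using sums_integral_count_space_nat[OF integrable_pmf, of X] by (simp add: integral_pmf)

lemma summable_pmf_nat: "summable (pmf (X :: nat pmf))"
  using pmf_nat_sums_1 by (rule sums_summable)

lemma alt_pgf_eq_gen_fun: "alt_pgf X s = gen_fun (pmf X) (1 - s)"
  by (simp add: alt_pgf_def gen_fun_def mult.commute)

lemma alt_pgf_0: "alt_pgf X 0 = 1"
  using pmf_nat_sums_1[of X] by (simp add: alt_pgf_eq_gen_fun gen_fun_def sums_iff)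

lemma alt_pgf_identity:
  assumes "0 < \<alpha>" "\<alpha> \<le> 1" and "S \<subseteq> {0<..<2}" "x \<in> S" "x islimpt S"
    and "\<And>s. s \<in> S \<Longrightarrow> alt_pgf Z (\<alpha> * s) = alt_pgf X s" and "s \<in> {0..2}"
  shows "alt_pgf Z (\<alpha> * s) = alt_pgf X s"
  using gen_fun_identity[of "pmf Z" "pmf X" \<alpha> S x s] assms
  by (simp add: alt_pgf_eq_gen_fun summable_pmf_nat)

lemma alt_pgf_inject:
  assumes "\<And>s. s \<in> {0<..<2} \<Longrightarrow> alt_pgf X s = alt_pgf X' s"
  shows "X = X'"
proof (rule pmf_eqI)
  have "pmf X = pmf X'"
    by (rule gen_fun_coefficients_unique)
       (use assms in \<open>auto simp: alt_pgf_eq_gen_fun summable_pmf_nat\<close>)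
  then show "pmf X k = pmf X' k" for k by simp
qed

lemma continuous_on_alt_pgf: "continuous_on {0..2} (alt_pgf X)"
  unfolding alt_pgf_eq_gen_fun[abs_def]
  by (intro continuous_on_compose2[OF continuous_on_gen_fun] summable_pmf_nat continuous_intros) auto

lemma completely_monotone_alt_pgf:
  assumes "0 < c"
  shows "completely_monotone_on {0<..<c} (\<lambda>t. alt_pgf X (t / c))"
  unfolding alt_pgf_eq_gen_fun
  by (rule completely_monotone_gen_fun) (auto simp: summable_pmf_nat assms)

lemma tendsto_alt_pgf_at_right_0:
  assumes "0 < c"
  shows "((\<lambda>t. alt_pgf X (t / c)) \<longlongrightarrow> alt_pgf X (0 / c)) (at_right 0)"
proof -
  have "continuous_on {0..c} (\<lambda>t. alt_pgf X (t / c))"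
    using assms
    by (intro continuous_on_compose2[OF continuous_on_alt_pgf] continuous_intros)
       (auto simp: field_simps)
  from continuous_on_Icc_at_rightD[OF this assms] show ?thesis .
qed

lemma alt_pgf_eq_expectation:
  assumes "s \<in> {0..2}"
  shows "alt_pgf X s = measure_pmf.expectation X (\<lambda>k. (1 - s) ^ k)"
proof -
  have le1: "\<bar>1 - s\<bar> \<le> 1" using assms by auto
  have "measure_pmf.expectation X (\<lambda>k. (1 - s) ^ k) = (\<integral>k. pmf X k * (1 - s) ^ k \<partial>count_space UNIV)"
    unfolding measure_pmf_eq_density by (subst integral_density) auto
  also have "\<dots> = (\<Sum>k. pmf X k * (1 - s) ^ k)"
  proof (rule integral_count_space_nat, rule Bochner_Integration.integrable_bound)
    show "integrable (count_space UNIV) (pmf X)" by (rule integrable_pmf)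
    show "AE k in count_space UNIV. norm (pmf X k * (1 - s) ^ k) \<le> norm (pmf X k)"
      using le1 by (auto simp: abs_mult power_abs intro!: mult_right_le_one_le power_le_one)
  qed auto
  finally show ?thesis by (simp add: alt_pgf_def mult.commute)
qed

text \<open>
  Restricting to \<open>s \<le> 1\<close> makes the integrand nonnegative, so that generating functions can be
  computed with nonnegative integrals, where mixtures and products need no integrability conditions.
\<close>
lemma nn_integral_power_pmf:
  assumes "s \<in> {0..1}"
  shows "(\<integral>\<^sup>+k. ennreal ((1 - s) ^ k) \<partial>measure_pmf X) = ennreal (alt_pgf X s)"
proof -
  have "integrable (measure_pmf X) (\<lambda>k. (1 - s) ^ k)"
    using assms by (intro measure_pmf.integrable_const_bound[where B = 1] AE_I2) (auto intro: power_le_one)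
  then show ?thesis
    using assms by (subst nn_integral_eq_integral) (auto simp: alt_pgf_eq_expectation)
qed

lemma nn_integral_bernoulli_sum:
  fixes s \<alpha> :: real
  assumes "s \<in> {0..1}" "\<alpha> \<in> {0..1}"
  shows "(\<integral>\<^sup>+B. ennreal ((1 - s) ^ (\<Sum>i\<in>{1..n}. of_bool (B i)))
            \<partial>measure_pmf (Pi_pmf {1..n} False (\<lambda>_. bernoulli_pmf \<alpha>))) = ennreal ((1 - \<alpha> * s) ^ n)"
    (is "(\<integral>\<^sup>+B. _ \<partial>measure_pmf ?P) = _")
proof -
  have int: "integrable (measure_pmf ?P) (\<lambda>B. (1 - s) ^ (\<Sum>i\<in>{1..n}. of_bool (B i)))"
    using assms by (intro measure_pmf.integrable_const_bound[where B = 1] AE_I2) (auto intro: power_le_one)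
  have "measure_pmf.expectation ?P (\<lambda>B. (1 - s) ^ (\<Sum>i\<in>{1..n}. of_bool (B i))) =
        measure_pmf.expectation ?P (\<lambda>B. \<Prod>i\<in>{1..n}. (1 - s) ^ of_bool (B i))"
    by (simp only: power_sum)
  also have "\<dots> = (\<Prod>i\<in>{1..n}. measure_pmf.expectation (bernoulli_pmf \<alpha>) (\<lambda>b. (1 - s) ^ of_bool b))"
    using assms by (intro expectation_prod_Pi_pmf integrable_measure_pmf_finite) auto
  also have "\<dots> = (1 - \<alpha> * s) ^ n"
    using assms by (simp add: algebra_simps)
  finally show ?thesis
    using assms by (subst nn_integral_eq_integral[OF int]) auto
qed

text \<open>
  Conditionally on \<open>Z = n\<close>, each of the \<open>n\<close> independent Bernoulli factors contributes \<open>1 - \<alpha> s\<close>. This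
  gives the identity for \<open>s\<close> in \<open>(0,1)\<close>, and analytic continuation extends it to \<open>[0,2]\<close>.
\<close>
lemma alt_pgf_thin:
  assumes \<alpha>: "0 < \<alpha>" "\<alpha> \<le> 1" and s: "s \<in> {0..2}"
  shows "alt_pgf (thin \<alpha> Z) s = alt_pgf Z (\<alpha> * s)"
proof -
  have "alt_pgf Z (\<alpha> * t) = alt_pgf (thin \<alpha> Z) t" if t: "t \<in> {0<..<1}" for t
  proof -
    have \<alpha>t: "\<alpha> * t \<in> {0..1}" using t \<alpha> by (auto intro!: mult_le_one)
    have "ennreal (alt_pgf (thin \<alpha> Z) t) = (\<integral>\<^sup>+k. ennreal ((1 - t) ^ k) \<partial>measure_pmf (thin \<alpha> Z))"
      using t by (subst nn_integral_power_pmf) auto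
    also have "\<dots> = (\<integral>\<^sup>+n. ennreal ((1 - \<alpha> * t) ^ n) \<partial>measure_pmf Z)"
      unfolding thin_def nn_integral_bind_pmf nn_integral_map_pmf
      using t \<alpha> by (subst nn_integral_bernoulli_sum) auto
    also have "\<dots> = ennreal (alt_pgf Z (\<alpha> * t))"
      by (rule nn_integral_power_pmf[OF \<alpha>t])
    finally show ?thesis
      using t \<alpha>t by (subst (asm) ennreal_inj) (auto simp: alt_pgf_eq_expectation)
  qed
  then show ?thesis
    by (intro alt_pgf_identity[symmetric, where S = "{0<..<1}" and x = "1/2"] \<alpha> s)
       (auto simp: interior_limit_point)
qed

text \<open>
  The Bernstein coefficients of \<open>f\<close> at \<open>1/\<alpha>\<close>, rescaled by powers of \<open>1/\<alpha>\<close>, are the probabilities of \<open>Z\<close>.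
  They are summable because \<open>f\<close> is bounded near \<open>0\<close>, and their sum is the value of the generating
  function of \<open>X\<close> at \<open>0\<close>.
\<close>
lemma thinned_if_completely_monotone:
  assumes \<alpha>: "0 < \<alpha>" "\<alpha> \<le> 1"
    and cm: "completely_monotone_on {0<..<1/\<alpha>} f" and lim: "(f \<longlongrightarrow> f 0) (at_right 0)"
    and S: "S \<subseteq> {0<..<min (1/\<alpha>) 2}" "x \<in> S" "x islimpt S"
    and eq: "\<And>s. s \<in> S \<Longrightarrow> f s = alt_pgf X s"
  shows "X \<in> thinned \<alpha>"
proof -
  obtain a where a: "\<And>k. 0 \<le> a k"
    and series: "\<And>s. s \<in> {0<..<1/\<alpha>} \<Longrightarrow> (\<lambda>k. a k * (1/\<alpha> - s) ^ k) sums f s"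
    using completely_monotone_power_series[OF cm] \<alpha> by auto
  define b where "b k = a k / \<alpha> ^ k" for k
  have b: "0 \<le> b k" for k using a \<alpha> by (simp add: b_def)
  have b_sums: "(\<lambda>k. b k * (1 - \<alpha> * s) ^ k) sums f s" if "s \<in> {0<..<1/\<alpha>}" for s
  proof -
    have "a k * (1/\<alpha> - s) ^ k = b k * (1 - \<alpha> * s) ^ k" for k
    proof -
      have "1/\<alpha> - s = (1 - \<alpha> * s) / \<alpha>" using \<alpha> by (simp add: field_simps)
      then show ?thesis by (simp add: b_def power_divide)
    qed
    then show ?thesis using series[OF that] by simp
  qed
  have b_sums': "(\<lambda>k. b k * y ^ k) sums f ((1 - y) / \<alpha>)" if "y \<in> {0<..<1}" for y
    using b_sums[of "(1 - y) / \<alpha>"] that \<alpha> by (simp add: field_simps)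
  have b_summable: "summable b"
  proof (rule summable_coefficients_if_bounded[OF b])
    show "summable (\<lambda>k. b k * y ^ k)" if "y \<in> {0<..<1}" for y
      using b_sums'[OF that] by (rule sums_summable)
    have "eventually (\<lambda>s. f s < f 0 + 1) (at_right 0)"
      using lim by (rule order_tendstoD) simp
    then obtain d where d: "0 < d" "\<And>s. 0 < s \<Longrightarrow> s < d \<Longrightarrow> f s < f 0 + 1"
      by (auto simp: eventually_at_right_field)
    have "eventually (\<lambda>y. y \<in> {max 0 (1 - \<alpha> * d)<..<1}) (at_left (1 :: real))"
      using d \<alpha> by (intro eventually_at_leftI[of "max 0 (1 - \<alpha> * d)"]) auto
    then show "eventually (\<lambda>y. (\<Sum>k. b k * y ^ k) \<le> f 0 + 1) (at_left 1)"
    proof eventually_elim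
      case (elim y)
      then show ?case
        using b_sums'[of y] d(2)[of "(1 - y) / \<alpha>"] \<alpha> by (auto simp: sums_iff field_simps)
    qed
  qed
  \<comment> \<open>analytic continuation from \<open>S\<close> to \<open>[0,2]\<close>\<close>
  have id: "gen_fun b (1 - \<alpha> * s) = gen_fun (pmf X) (1 - s)" if "s \<in> {0..2}" for s
  proof (rule gen_fun_identity[OF b b_summable pmf_nonneg summable_pmf_nat \<alpha> _ S(2,3) _ that])
    fix s assume "s \<in> S"
    then show "gen_fun b (1 - \<alpha> * s) = gen_fun (pmf X) (1 - s)"
      using b_sums[of s] S(1) eq[of s] by (auto simp: gen_fun_def sums_iff alt_pgf_eq_gen_fun)
  qed (use S in auto)
  have "(\<Sum>k. b k) = 1"
    using id[of 0] alt_pgf_0[of X] by (simp add: gen_fun_def alt_pgf_eq_gen_fun)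
  then have "(\<integral>\<^sup>+k. ennreal (b k) \<partial>count_space UNIV) = 1"
    by (subst nn_integral_count_space_nat) (use b b_summable in \<open>auto simp: suminf_ennreal2\<close>)
  then have Z: "pmf (embed_pmf b) k = b k" for k
    by (intro pmf_embed_pmf b)
  have "X = thin \<alpha> (embed_pmf b)"
  proof (rule alt_pgf_inject)
    fix s :: real assume "s \<in> {0<..<2}"
    then show "alt_pgf X s = alt_pgf (thin \<alpha> (embed_pmf b)) s"
      using id[of s] by (subst alt_pgf_thin[OF \<alpha>]) (auto simp: alt_pgf_eq_gen_fun Z[abs_def])
  qed
  then show ?thesis by (auto simp: thinned_def)
qed

lemma completely_monotone_if_thinned:
  assumes \<alpha>: "0 < \<alpha>" "\<alpha> \<le> 1" and "X \<in> thinned \<alpha>"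
  obtains f where "completely_monotone_on {0<..<1/\<alpha>} f" "(f \<longlongrightarrow> f 0) (at_right 0)"
    "\<And>s. s \<in> {0..2} \<Longrightarrow> f s = alt_pgf X s"
proof -
  obtain Z where X: "X = thin \<alpha> Z" using assms(3) by (auto simp: thinned_def)
  show ?thesis
    using that[of "\<lambda>t. alt_pgf Z (t / (1/\<alpha>))"] completely_monotone_alt_pgf[of "1/\<alpha>" Z]
      tendsto_alt_pgf_at_right_0[of "1/\<alpha>" Z] \<alpha> alt_pgf_thin[OF \<alpha>, of _ Z]
    by (simp add: X mult.commute)
qed

section \<open>Poisson mixtures and Laplace transforms\<close>

lemma pmf_poisson0: "0 \<le> r \<Longrightarrow> pmf (poisson0_pmf r) k = r ^ k / fact k * exp (- r)"
  by (cases k) (auto simp: poisson0_pmf_def pmf_return)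

lemma alt_pgf_poisson0_sums:
  assumes "0 \<le> r"
  shows "(\<lambda>k. (1 - s) ^ k * pmf (poisson0_pmf r) k) sums exp (- s * r)"
proof -
  have "(\<lambda>k. ((1 - s) * r) ^ k /\<^sub>R fact k * exp (- r)) sums (exp ((1 - s) * r) * exp (- r))"
    by (intro sums_mult2 exp_converges)
  also have "exp ((1 - s) * r) * exp (- r) = exp (- s * r)"
    by (simp add: exp_add[symmetric] algebra_simps)
  also have "(\<lambda>k. ((1 - s) * r) ^ k /\<^sub>R fact k * exp (- r)) = (\<lambda>k. (1 - s) ^ k * pmf (poisson0_pmf r) k)"
    using assms by (simp add: fun_eq_iff pmf_poisson0 power_mult_distrib divide_inverse mult_ac)
  finally show ?thesis .
qed

lemma measurable_pmf_poisson0 [measurable]: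
  "(\<lambda>y. pmf (poisson0_pmf \<bar>y\<bar>) k) \<in> borel_measurable borel"
  by (simp add: pmf_poisson0)

lemma nonneg_rv_prob_space: "nonneg_rv M Y \<Longrightarrow> prob_space M"
  by (simp add: nonneg_rv_def)

lemma nonneg_rv_measurable: "nonneg_rv M Y \<Longrightarrow> Y \<in> borel_measurable M"
  by (simp add: nonneg_rv_def)

lemma nonneg_rv_nonneg: "nonneg_rv M Y \<Longrightarrow> \<omega> \<in> space M \<Longrightarrow> 0 \<le> Y \<omega>"
  by (simp add: nonneg_rv_def)

lemma measurable_pmf_poisson0_rv:
  assumes "nonneg_rv M Y"
  shows "(\<lambda>\<omega>. pmf (poisson0_pmf (Y \<omega>)) k) \<in> borel_measurable M"
proof -
  have "(\<lambda>\<omega>. pmf (poisson0_pmf \<bar>Y \<omega>\<bar>) k) \<in> borel_measurable M"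
    by (rule measurable_compose[OF nonneg_rv_measurable[OF assms] measurable_pmf_poisson0])
  then show ?thesis
    by (rule measurable_cong[THEN iffD1, rotated]) (simp add: nonneg_rv_nonneg[OF assms])
qed

lemma integrable_pmf_poisson0:
  assumes "nonneg_rv M Y"
  shows "integrable M (\<lambda>\<omega>. pmf (poisson0_pmf (Y \<omega>)) k)"
proof -
  interpret prob_space M by (rule nonneg_rv_prob_space[OF assms])
  show ?thesis
    by (rule integrable_const_bound[where B = 1])
       (auto simp: pmf_le_1 measurable_pmf_poisson0_rv[OF assms])
qed

text \<open>
  The unconditional form of a mixed Poisson law: its point probabilities are averages of Poisson
  probabilities. It involves the mixing variable alone, without a joint law.
\<close>
definition poisson_mixture :: "'a measure \<Rightarrow> ('a \<Rightarrow> real) \<Rightarrow> nat pmf \<Rightarrow> bool" where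
  "poisson_mixture M Y X \<longleftrightarrow>
     nonneg_rv M Y \<and> (\<forall>k. pmf X k = (\<integral>\<omega>. pmf (poisson0_pmf (Y \<omega>)) k \<partial>M))"

text \<open>
  Passing to the law of \<open>Y\<close> on the real line, the mixing variable becomes the absolute value, which
  is nonnegative on the whole line and agrees with the identity almost everywhere.
\<close>
lemma nonneg_rv_distr_abs:
  assumes "nonneg_rv M Y"
  shows "nonneg_rv (distr M borel Y) abs"
  using assms by (auto simp: nonneg_rv_def intro: prob_space.prob_space_distr)

lemma poisson_mixture_distr_abs:
  assumes "poisson_mixture M Y X"
  shows "poisson_mixture (distr M borel Y) abs X"
proof -
  have Y: "nonneg_rv M Y" using assms by (simp add: poisson_mixture_def)
  have "(\<integral>y. pmf (poisson0_pmf \<bar>y\<bar>) k \<partial>distr M borel Y) = (\<integral>\<omega>. pmf (poisson0_pmf (Y \<omega>)) k \<partial>M)" for k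
    using nonneg_rv_measurable[OF Y]
    by (auto simp: integral_distr nonneg_rv_nonneg[OF Y] intro!: Bochner_Integration.integral_cong)
  then show ?thesis
    using assms nonneg_rv_distr_abs[OF Y] by (simp add: poisson_mixture_def)
qed

text \<open>
  Integrate the series \<open>exp (- s Y)\<close> of the conditional generating function term by term; the terms
  are dominated by the Poisson probabilities because \<open>\<bar>1 - s\<bar> \<le> 1\<close>.
\<close>
lemma alt_pgf_poisson_mixture:
  assumes mix: "poisson_mixture M Y X" and s: "s \<in> {0..2}"
  shows "alt_pgf X s = laplace M Y s"
proof -
  have Y: "nonneg_rv M Y" and X: "pmf X k = (\<integral>\<omega>. pmf (poisson0_pmf (Y \<omega>)) k \<partial>M)" for k
    using mix by (auto simp: poisson_mixture_def)
  have le1: "\<bar>1 - s\<bar> \<le> 1" using s by auto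
  define f where "f k \<omega> = (1 - s) ^ k * pmf (poisson0_pmf (Y \<omega>)) k" for k \<omega>
  have int: "integrable M (f k)" for k
    unfolding f_def[abs_def] by (intro integrable_mult_right integrable_pmf_poisson0[OF Y])
  have norm_le: "norm (f k \<omega>) \<le> pmf (poisson0_pmf (Y \<omega>)) k" for k \<omega>
    using le1 by (auto simp: f_def abs_mult power_abs intro!: mult_left_le_one_le power_le_one)
  have "(\<lambda>k. integral\<^sup>L M (f k)) sums (\<integral>\<omega>. (\<Sum>k. f k \<omega>) \<partial>M)"
  proof (rule sums_integral[OF int])
    show "AE \<omega> in M. summable (\<lambda>k. norm (f k \<omega>))"
      by (intro AE_I2 summable_comparison_test'[OF summable_pmf_nat]) (use norm_le in auto)
    have "norm (\<integral>\<omega>. norm (f k \<omega>) \<partial>M) \<le> pmf X k" for k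
      using integral_mono[OF integrable_norm[OF int] integrable_pmf_poisson0[OF Y] norm_le]
      by (simp add: X integral_nonneg_AE)
    then show "summable (\<lambda>k. \<integral>\<omega>. norm (f k \<omega>) \<partial>M)"
      by (intro summable_comparison_test'[OF summable_pmf_nat]) auto
  qed
  moreover have "integral\<^sup>L M (f k) = (1 - s) ^ k * pmf X k" for k
    by (simp add: f_def[abs_def] X)
  moreover have "(\<integral>\<omega>. (\<Sum>k. f k \<omega>) \<partial>M) = laplace M Y s"
    unfolding laplace_def
  proof (rule Bochner_Integration.integral_cong[OF refl])
    fix \<omega> assume "\<omega> \<in> space M"
    then show "(\<Sum>k. f k \<omega>) = exp (- s * Y \<omega>)"
      using alt_pgf_poisson0_sums[OF nonneg_rv_nonneg[OF Y], of \<omega> s] by (simp add: f_def sums_iff)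
  qed
  ultimately show ?thesis by (simp add: alt_pgf_def sums_iff)
qed

lemma poisson_mixture_exists:
  assumes Y: "nonneg_rv M Y"
  obtains X where "poisson_mixture M Y X"
proof -
  interpret prob_space M by (rule nonneg_rv_prob_space[OF Y])
  define q where "q k = (\<integral>\<omega>. pmf (poisson0_pmf (Y \<omega>)) k \<partial>M)" for k
  have "(\<integral>\<^sup>+k. ennreal (q k) \<partial>count_space UNIV) = (\<Sum>k. \<integral>\<^sup>+\<omega>. ennreal (pmf (poisson0_pmf (Y \<omega>)) k) \<partial>M)"
    by (simp add: nn_integral_count_space_nat q_def nn_integral_eq_integral[OF integrable_pmf_poisson0[OF Y]])
  also have "\<dots> = (\<integral>\<^sup>+\<omega>. (\<Sum>k. ennreal (pmf (poisson0_pmf (Y \<omega>)) k)) \<partial>M)"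
    using measurable_pmf_poisson0_rv[OF Y] by (intro nn_integral_suminf[symmetric]) measurable
  also have "\<dots> = (\<integral>\<^sup>+\<omega>. 1 \<partial>M)"
    using pmf_nat_sums_1 by (simp add: suminf_ennreal2 sums_iff)
  also have "\<dots> = 1" by (simp add: emeasure_space_1)
  finally have "pmf (embed_pmf q) k = q k" for k
    by (intro pmf_embed_pmf) (simp_all add: q_def integral_nonneg_AE)
  then show ?thesis
    using that[of "embed_pmf q"] Y by (simp add: poisson_mixture_def q_def)
qed

text \<open>Taking expectations of the conditional probabilities.\<close>
lemma poisson_mixture_if_mixed_poisson:
  assumes "mixed_poisson X"
  obtains M :: "(real \<times> nat) measure" and Y where "poisson_mixture M Y X"
proof -
  obtain M :: "(real \<times> nat) measure" and N Y where Y: "nonneg_rv M Y"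
    and N: "N \<in> measurable M (count_space UNIV)" "distr M (count_space UNIV) N = measure_pmf X"
    and cond: "\<And>k. AE \<omega> in M. real_cond_exp M (vimage_algebra (space M) Y borel)
             (indicator {\<omega> \<in> space M. N \<omega> = k}) \<omega> = pmf (poisson0_pmf (Y \<omega>)) k"
    using assms unfolding mixed_poisson_def by blast
  interpret prob_space M by (rule nonneg_rv_prob_space[OF Y])
  have "subalgebra M (vimage_algebra (space M) Y borel)"
    unfolding subalgebra_def using nonneg_rv_measurable[OF Y] by (simp add: measurable_iff_sets)
  then interpret finite_measure_subalgebra M "vimage_algebra (space M) Y borel"
    by unfold_locales
  have "pmf X k = (\<integral>\<omega>. pmf (poisson0_pmf (Y \<omega>)) k \<partial>M)" for k
  proof -
    let ?A = "{\<omega> \<in> space M. N \<omega> = k}"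
    have A: "?A = N -` {k} \<inter> space M" by auto
    have A_sets: "?A \<in> sets M" unfolding A using N(1) by (rule measurable_sets) simp
    have "pmf X k = measure (distr M (count_space UNIV) N) {k}"
      by (simp add: N(2) pmf.rep_eq)
    also have "\<dots> = measure M ?A" unfolding A using N(1) by (simp add: measure_distr)
    also have "\<dots> = (\<integral>\<omega>. indicator ?A \<omega> \<partial>M)" using A_sets by simp
    also have "\<dots> = (\<integral>\<omega>. real_cond_exp M (vimage_algebra (space M) Y borel) (indicator ?A) \<omega> \<partial>M)"
      using A_sets by (intro real_cond_exp_int(2)[symmetric]) (simp add: emeasure_finite less_top[symmetric])
    also have "\<dots> = (\<integral>\<omega>. pmf (poisson0_pmf (Y \<omega>)) k \<partial>M)"
      by (rule integral_cong_AE) (use cond[of k] measurable_pmf_poisson0_rv[OF Y] in auto)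
    finally show ?thesis .
  qed
  then show ?thesis using that Y by (auto simp: poisson_mixture_def)
qed

text \<open>
  The joint law of the mixing variable and the mixed Poisson variable, given by its density with
  respect to the product of \<open>P\<close> and counting measure.
\<close>
definition poisson_joint :: "real measure \<Rightarrow> (real \<times> nat) measure" where
  "poisson_joint P = density (P \<Otimes>\<^sub>M count_space UNIV) (\<lambda>(y, k). ennreal (pmf (poisson0_pmf \<bar>y\<bar>) k))"

lemma nn_integral_poisson_joint:
  assumes [measurable_cong]: "sets P = sets borel"
    and g [measurable]: "g \<in> borel_measurable (P \<Otimes>\<^sub>M count_space UNIV)"
  shows "(\<integral>\<^sup>+x. g x \<partial>poisson_joint P) = (\<integral>\<^sup>+y. \<integral>\<^sup>+k. g (y, k) \<partial>measure_pmf (poisson0_pmf \<bar>y\<bar>) \<partial>P)"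
proof -
  interpret C: sigma_finite_measure "count_space (UNIV :: nat set)"
    by (rule sigma_finite_measure_count_space)
  have [measurable]: "(\<lambda>x. pmf (poisson0_pmf \<bar>fst x\<bar>) (snd x)) \<in> borel_measurable (P \<Otimes>\<^sub>M count_space UNIV)"
  proof (rule measurable_compose_countable[where f = "\<lambda>k x. pmf (poisson0_pmf \<bar>fst x\<bar>) k" and g = snd])
    show "(\<lambda>x. pmf (poisson0_pmf \<bar>fst x\<bar>) k) \<in> borel_measurable (P \<Otimes>\<^sub>M count_space UNIV)" for k
      by measurable
  qed simp
  show ?thesis
    unfolding poisson_joint_def case_prod_beta
    by (subst nn_integral_density) (simp_all add: C.nn_integral_fst[symmetric] nn_integral_measure_pmf)
qed

text \<open>
  On the joint law, the second coordinate has law \<open>X\<close>. That its conditional law is Poisson is checked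
  on the events \<open>Y' \<in> B\<close>, where both sides integrate to
  \<open>\<integral> 1\<^sub>B(\<bar>y\<bar>) pmf (poisson0_pmf \<bar>y\<bar>) k dP(y)\<close>.
\<close>
lemma mixed_poisson_if_poisson_mixture:
  assumes "poisson_mixture M Y X"
  shows "mixed_poisson X"
proof -
  define P where "P = distr M borel Y"
  have mix: "poisson_mixture P abs X"
    unfolding P_def by (rule poisson_mixture_distr_abs[OF assms])
  then have P: "nonneg_rv P abs" and X: "pmf X k = (\<integral>y. pmf (poisson0_pmf \<bar>y\<bar>) k \<partial>P)" for k
    by (auto simp: poisson_mixture_def)
  have sets_P [measurable_cong]: "sets P = sets borel" by (simp add: P_def)
  interpret P: prob_space P by (rule nonneg_rv_prob_space[OF P])
  define J where "J = poisson_joint P"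
  define Y' :: "real \<times> nat \<Rightarrow> real" where "Y' x = \<bar>fst x\<bar>" for x
  note nn_J = nn_integral_poisson_joint[OF sets_P, folded J_def]
  have sets_J [measurable_cong]: "sets J = sets (P \<Otimes>\<^sub>M count_space UNIV)"
    by (simp add: J_def poisson_joint_def)
  have "emeasure J (space J) = (\<integral>\<^sup>+x. 1 \<partial>J)" by simp
  also have "\<dots> = 1"
    by (subst nn_J) (simp_all add: P.emeasure_space_1 measure_pmf.emeasure_space_1[simplified])
  finally interpret J: prob_space J by (rule prob_spaceI)
  have Y'_meas [measurable]: "Y' \<in> borel_measurable J"
    unfolding Y'_def[abs_def] by measurable
  have Y': "nonneg_rv J Y'"
    by (auto simp: nonneg_rv_def J.prob_space_axioms) (simp add: Y'_def)
  have snd_meas [measurable]: "snd \<in> measurable J (count_space UNIV)"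
    by measurable
  let ?F = "vimage_algebra (space J) Y' borel"
  have subalg: "subalgebra J ?F"
    unfolding subalgebra_def using Y'_meas by (simp add: measurable_iff_sets)
  then interpret finite_measure_subalgebra J ?F
    by unfold_locales
  have event: "(\<integral>\<^sup>+x. indicator B (Y' x) * indicator {k} (snd x) \<partial>J) =
      (\<integral>\<^sup>+y. indicator B \<bar>y\<bar> * ennreal (pmf (poisson0_pmf \<bar>y\<bar>) k) \<partial>P)"
    if [measurable]: "B \<in> sets borel" for B k
  proof -
    have "(\<lambda>x. indicator B \<bar>fst x\<bar> * indicator {k} (snd x) :: ennreal) \<in> borel_measurable (P \<Otimes>\<^sub>M count_space UNIV)"
    proof (intro borel_measurable_times_ennreal)
      have "(\<lambda>y. indicator B \<bar>y\<bar> :: ennreal) \<in> borel_measurable P" by measurable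
      then show "(\<lambda>x. indicator B \<bar>fst x\<bar> :: ennreal) \<in> borel_measurable (P \<Otimes>\<^sub>M count_space UNIV)"
        by (rule measurable_compose[OF measurable_fst])
      show "(\<lambda>x. indicator {k} (snd x) :: ennreal) \<in> borel_measurable (P \<Otimes>\<^sub>M count_space UNIV)"
        by (rule measurable_compose[OF measurable_snd]) simp
    qed
    from nn_J[OF this] show ?thesis
      by (simp add: Y'_def nn_integral_cmult emeasure_pmf_single)
  qed
  have distr: "distr J (count_space UNIV) snd = measure_pmf X"
  proof (rule measure_eqI_countable[where A = UNIV])
    fix k
    have "emeasure (distr J (count_space UNIV) snd) {k} = (\<integral>\<^sup>+x. indicator UNIV (Y' x) * indicator {k} (snd x) \<partial>J)"
      by (simp add: nn_integral_indicator[symmetric] nn_integral_distr del: nn_integral_indicator)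
    also have "\<dots> = (\<integral>\<^sup>+y. ennreal (pmf (poisson0_pmf \<bar>y\<bar>) k) \<partial>P)"
      by (subst event) simp_all
    also have "\<dots> = emeasure (measure_pmf X) {k}"
      by (simp add: emeasure_pmf_single X nn_integral_eq_integral[OF integrable_pmf_poisson0[OF P]])
    finally show "emeasure (distr J (count_space UNIV) snd) {k} = emeasure (measure_pmf X) {k}" .
  qed auto
  have cond: "AE x in J. real_cond_exp J ?F (indicator {x \<in> space J. snd x = k}) x = pmf (poisson0_pmf (Y' x)) k" for k
  proof (rule real_cond_exp_charact)
    have K [measurable]: "{x \<in> space J. snd x = k} \<in> sets J" by measurable
    show "integrable J (indicator {x \<in> space J. snd x = k} :: _ \<Rightarrow> real)"
      using K by (simp add: J.emeasure_finite less_top[symmetric])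
    show "integrable J (\<lambda>x. pmf (poisson0_pmf (Y' x)) k)"
      by (rule integrable_pmf_poisson0[OF Y'])
    have "(\<lambda>x. pmf (poisson0_pmf \<bar>Y' x\<bar>) k) \<in> borel_measurable ?F"
      by (rule measurable_compose[OF measurable_vimage_algebra1 measurable_pmf_poisson0]) auto
    then show "(\<lambda>x. pmf (poisson0_pmf (Y' x)) k) \<in> borel_measurable ?F"
      by (simp add: Y'_def)
    fix A assume "A \<in> sets ?F"
    then obtain B where [measurable]: "B \<in> sets borel" and A: "A = Y' -` B \<inter> space J"
      by (auto simp: sets_vimage_algebra2)
    have meas: "(\<lambda>x. indicator B (Y' x) * indicator {k} (snd x) :: real) \<in> borel_measurable J"
      by (intro borel_measurable_times measurable_compose[OF Y'_meas] measurable_compose[OF snd_meas]) simp_all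
    have "(\<integral>x\<in>A. indicator {x \<in> space J. snd x = k} x \<partial>J) =
          (\<integral>x. (indicator B (Y' x) * indicator {k} (snd x) :: real) \<partial>J)"
      unfolding set_lebesgue_integral_def A
      by (rule Bochner_Integration.integral_cong) (auto simp: indicator_def)
    also have "\<dots> = enn2real (\<integral>\<^sup>+x. indicator B (Y' x) * indicator {k} (snd x) \<partial>J)"
      using meas by (subst integral_eq_nn_integral) (auto simp: ennreal_mult' ennreal_indicator)
    also have "\<dots> = enn2real (\<integral>\<^sup>+y. indicator B \<bar>y\<bar> * ennreal (pmf (poisson0_pmf \<bar>y\<bar>) k) \<partial>P)"
      by (subst event) simp_all
    also have "\<dots> = enn2real (\<integral>\<^sup>+x. indicator B (Y' x) * ennreal (pmf (poisson0_pmf (Y' x)) k) \<partial>J)"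
      unfolding Y'_def
      by (subst nn_J) (simp_all add: measure_pmf.emeasure_space_1[simplified])
    also have "\<dots> = (\<integral>x. indicator B (Y' x) * pmf (poisson0_pmf (Y' x)) k \<partial>J)"
      using measurable_pmf_poisson0_rv[OF Y']
      by (subst integral_eq_nn_integral) (auto simp: ennreal_mult' ennreal_indicator)
    also have "\<dots> = (\<integral>x\<in>A. pmf (poisson0_pmf (Y' x)) k \<partial>J)"
      unfolding set_lebesgue_integral_def A
      by (rule Bochner_Integration.integral_cong) (auto simp: indicator_def)
    finally show "(\<integral>x\<in>A. indicator {x \<in> space J. snd x = k} x \<partial>J) = (\<integral>x\<in>A. pmf (poisson0_pmf (Y' x)) k \<partial>J)" .
  qed
  show ?thesis
    unfolding mixed_poisson_def using Y' snd_meas distr cond by blast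
qed

text \<open>
  For the converse, the Poisson mixture with mixing variable \<open>Y\<close> has the same generating function as
  \<open>X\<close>, so it is the law of \<open>X\<close>.
\<close>
theorem mixed_poisson_iff_laplace:
  "mixed_poisson X \<longleftrightarrow>
     (\<exists>(M :: real measure) Y. nonneg_rv M Y \<and> (\<forall>s\<in>{0..2}. alt_pgf X s = laplace M Y s))"
proof
  assume "mixed_poisson X"
  then obtain M :: "(real \<times> nat) measure" and Y where "poisson_mixture M Y X"
    by (rule poisson_mixture_if_mixed_poisson)
  then have mix: "poisson_mixture (distr M borel Y) abs X" by (rule poisson_mixture_distr_abs)
  then have "nonneg_rv (distr M borel Y) abs" by (simp add: poisson_mixture_def)
  then show "\<exists>(M :: real measure) Y. nonneg_rv M Y \<and> (\<forall>s\<in>{0..2}. alt_pgf X s = laplace M Y s)"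
    using alt_pgf_poisson_mixture[OF mix] by blast
next
  assume "\<exists>(M :: real measure) Y. nonneg_rv M Y \<and> (\<forall>s\<in>{0..2}. alt_pgf X s = laplace M Y s)"
  then obtain M :: "real measure" and Y where Y: "nonneg_rv M Y"
    and X: "\<And>s. s \<in> {0..2} \<Longrightarrow> alt_pgf X s = laplace M Y s" by blast
  obtain Q where Q: "poisson_mixture M Y Q" by (rule poisson_mixture_exists[OF Y])
  have "X = Q"
    by (rule alt_pgf_inject) (simp add: X alt_pgf_poisson_mixture[OF Q])
  then show "mixed_poisson X" using mixed_poisson_if_poisson_mixture[OF Q] by simp
qed

text \<open>
  Scaling the mixing variable by \<open>c\<close> turns the Laplace transform on the long interval \<open>[0,2c]\<close> into a
  generating function. Complete monotonicity of Laplace transforms then follows without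
  differentiating under the integral.
\<close>
lemma laplace_eq_alt_pgf:
  assumes "nonneg_rv M Y" and "0 < c"
  obtains Q where "\<And>t. t \<in> {0..2 * c} \<Longrightarrow> laplace M Y t = alt_pgf Q (t / c)"
proof -
  have cY: "nonneg_rv M (\<lambda>\<omega>. c * Y \<omega>)"
    using assms by (auto simp: nonneg_rv_def)
  obtain Q where Q: "poisson_mixture M (\<lambda>\<omega>. c * Y \<omega>) Q" by (rule poisson_mixture_exists[OF cY])
  show ?thesis
  proof (rule that)
    fix t assume "t \<in> {0..2 * c}"
    then have "alt_pgf Q (t / c) = laplace M (\<lambda>\<omega>. c * Y \<omega>) (t / c)"
      using assms(2) by (intro alt_pgf_poisson_mixture[OF Q]) (auto simp: field_simps)
    also have "\<dots> = laplace M Y t" using assms(2) by (simp add: laplace_def)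
    finally show "laplace M Y t = alt_pgf Q (t / c)" by simp
  qed
qed

text \<open>On an open set, all iterated derivatives depend only on the values there.\<close>
lemma completely_monotone_on_cong_open:
  assumes "open I" and eq: "\<And>t. t \<in> I \<Longrightarrow> f t = g t" and "completely_monotone_on I g"
  shows "completely_monotone_on I f"
proof -
  have deriv: "(deriv ^^ n) f t = (deriv ^^ n) g t" if "t \<in> I" for n t
    using that
  proof (induction n arbitrary: t)
    case (Suc n)
    have "deriv ((deriv ^^ n) f) t = deriv ((deriv ^^ n) g) t"
      using Suc assms(1) by (intro deriv_cong_ev refl) (auto simp: eventually_nhds)
    then show ?case by simp
  qed (simp add: eq)
  have "(deriv ^^ n) f field_differentiable (at t)" if "t \<in> I" for n t
  proof -
    obtain D where "((deriv ^^ n) g has_field_derivative D) (at t)"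
      using assms(3) \<open>t \<in> I\<close> by (auto simp: completely_monotone_on_def field_differentiable_def)
    then have "((deriv ^^ n) f has_field_derivative D) (at t)"
      by (rule has_field_derivative_transform_within_open[OF _ assms(1) that]) (simp add: deriv)
    then show ?thesis by (auto simp: field_differentiable_def)
  qed
  then show ?thesis
    using assms(3) by (simp add: completely_monotone_on_def deriv)
qed

lemma completely_monotone_laplace:
  assumes Y: "nonneg_rv M Y"
  shows "completely_monotone_on {0<..} (laplace M Y)"
proof -
  have bounded: "completely_monotone_on {0<..<c} (laplace M Y)" if c: "0 < c" for c
  proof -
    obtain Q where "\<And>t. t \<in> {0..2 * c} \<Longrightarrow> laplace M Y t = alt_pgf Q (t / c)"
      using laplace_eq_alt_pgf[OF Y c] by metis
    then show ?thesis
      by (intro completely_monotone_on_cong_open[OF _ _ completely_monotone_alt_pgf[OF c]]) (use c in auto)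
  qed
  then show ?thesis
    unfolding completely_monotone_on_def
  proof (intro allI ballI)
    fix n and t :: real assume "t \<in> {0<..}"
    then show "(deriv ^^ n) (laplace M Y) field_differentiable at t \<and> 0 \<le> (- 1) ^ n * (deriv ^^ n) (laplace M Y) t"
      using bounded[of "t + 1"] by (auto simp: completely_monotone_on_def)
  qed
qed

lemma tendsto_laplace_at_right_0:
  assumes Y: "nonneg_rv M Y"
  shows "(laplace M Y \<longlongrightarrow> laplace M Y 0) (at_right 0)"
proof -
  obtain Q where Q: "\<And>t. t \<in> {0..2 * 1} \<Longrightarrow> laplace M Y t = alt_pgf Q (t / 1)"
    using laplace_eq_alt_pgf[OF Y zero_less_one] by metis
  have "((\<lambda>t. alt_pgf Q (t / 1)) \<longlongrightarrow> laplace M Y 0) (at_right 0)"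
    using tendsto_alt_pgf_at_right_0[of 1 Q] Q[of 0] by simp
  moreover have "eventually (\<lambda>t. alt_pgf Q (t / 1) = laplace M Y t) (at_right 0)"
    using Q by (auto simp: eventually_at_right_field intro!: exI[of _ 1])
  ultimately show ?thesis by (rule Lim_transform_eventually)
qed

section \<open>Weak limits of rescaled laws\<close>

text \<open>
  The bound is uniform in \<open>y\<close> because \<open>x exp (- x) \<le> 1\<close>: the exponential damping in \<open>s y\<close> compensates
  the growth of \<open>(t - s) y\<close>.
\<close>
lemma exp_diff_le:
  fixes s t y :: real
  assumes "0 < s" "s \<le> t" "0 \<le> y"
  shows "\<bar>exp (- (s * y)) - exp (- (t * y))\<bar> \<le> (t - s) / s"
proof -
  have "exp (- (s * y)) - exp (- (t * y)) = exp (- (s * y)) * (1 - exp (- ((t - s) * y)))"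
    by (simp add: algebra_simps exp_add[symmetric])
  also have "\<dots> \<le> exp (- (s * y)) * ((t - s) * y)"
    using exp_ge_add_one_self[of "- ((t - s) * y)"] by (intro mult_left_mono) auto
  also have "\<dots> = (t - s) / s * (s * y * exp (- (s * y)))"
    using assms by (simp add: field_simps)
  also have "\<dots> \<le> (t - s) / s * 1"
  proof (rule mult_left_mono)
    \<comment> \<open>\<open>x exp (- x) \<le> 1\<close> at \<open>x = s y\<close>\<close>
    have "s * y \<le> exp (s * y)" using exp_ge_add_one_self[of "s * y"] by linarith
    then show "s * y * exp (- (s * y)) \<le> 1" by (simp add: exp_minus field_simps)
  qed (use assms in auto)
  finally have "exp (- (s * y)) - exp (- (t * y)) \<le> (t - s) / s" by simp
  moreover have "exp (- (t * y)) \<le> exp (- (s * y))"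
    using assms by (simp add: mult_right_mono)
  ultimately show ?thesis by simp
qed

definition scaled_law :: "nat pmf \<Rightarrow> real \<Rightarrow> real measure" where
  "scaled_law Z \<alpha> = distr (measure_pmf Z) borel (\<lambda>k. \<alpha> * real k)"

lemma real_distribution_scaled_law: "real_distribution (scaled_law Z \<alpha>)"
  unfolding scaled_law_def by (intro prob_space.real_distribution_distr prob_space_measure_pmf) simp

text \<open>
  Since \<open>(1 - \<alpha> s)^k = exp (- t \<alpha> k)\<close> for \<open>t = - ln (1 - \<alpha> s) / \<alpha>\<close>, the generating function is the
  Laplace transform of the scaled law at \<open>t\<close>, and \<open>t\<close> is close to \<open>s\<close> when \<open>\<alpha>\<close> is small. The absolute
  value makes the integrand bounded and continuous on the whole line, as weak convergence demands.
\<close>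
lemma alt_pgf_near_laplace:
  assumes \<alpha>: "0 < \<alpha>" and s: "0 < s" "\<alpha> * s < 1"
  shows "\<bar>(\<integral>y. exp (- (s * \<bar>y\<bar>)) \<partial>scaled_law Z \<alpha>) - alt_pgf Z (\<alpha> * s)\<bar> \<le> \<alpha> * s / (1 - \<alpha> * s)"
proof -
  define t where "t = - ln (1 - \<alpha> * s) / \<alpha>"
  have "s \<le> t"
    using ln_le_minus_one[of "1 - \<alpha> * s"] assms by (simp add: t_def field_simps)
  have pow: "(1 - \<alpha> * s) ^ k = exp (- (t * (\<alpha> * real k)))" for k
  proof -
    have "(1 - \<alpha> * s) ^ k = exp (real k * ln (1 - \<alpha> * s))"
      using assms by (simp add: exp_of_nat_mult)
    also have "real k * ln (1 - \<alpha> * s) = - (t * (\<alpha> * real k))"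
      using \<alpha> by (simp add: t_def)
    finally show ?thesis .
  qed
  have diff: "\<bar>exp (- (s * (\<alpha> * real k))) - exp (- (t * (\<alpha> * real k)))\<bar> \<le> (t - s) / s" for k
    using \<open>s \<le> t\<close> assms by (intro exp_diff_le) auto
  have int: "integrable (measure_pmf Z) (\<lambda>k. exp (- (r * (\<alpha> * real k))))" if "0 \<le> r" for r
    using that \<alpha> by (intro measure_pmf.integrable_const_bound[where B = 1] AE_I2) auto
  have "0 < \<alpha> * s" using assms by simp
  then have "alt_pgf Z (\<alpha> * s) = measure_pmf.expectation Z (\<lambda>k. exp (- (t * (\<alpha> * real k))))"
    using s by (subst alt_pgf_eq_expectation) (auto simp flip: pow)
  moreover have "(\<integral>y. exp (- (s * \<bar>y\<bar>)) \<partial>scaled_law Z \<alpha>) = measure_pmf.expectation Z (\<lambda>k. exp (- (s * (\<alpha> * real k))))"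
    using \<alpha> by (simp add: scaled_law_def integral_distr abs_mult)
  ultimately have "\<bar>(\<integral>y. exp (- (s * \<bar>y\<bar>)) \<partial>scaled_law Z \<alpha>) - alt_pgf Z (\<alpha> * s)\<bar> =
      \<bar>measure_pmf.expectation Z (\<lambda>k. exp (- (s * (\<alpha> * real k))) - exp (- (t * (\<alpha> * real k))))\<bar>"
    using \<open>s \<le> t\<close> s by (simp add: int)
  also have "\<dots> \<le> measure_pmf.expectation Z (\<lambda>k. \<bar>exp (- (s * (\<alpha> * real k))) - exp (- (t * (\<alpha> * real k)))\<bar>)"
    by (rule integral_abs_bound)
  also have "\<dots> \<le> measure_pmf.expectation Z (\<lambda>k. (t - s) / s)"
    using \<open>s \<le> t\<close> s diff by (intro integral_mono integrable_abs Bochner_Integration.integrable_diff int) auto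
  also have "\<dots> = (t - s) / s" by simp
  also have "\<dots> \<le> \<alpha> * s / (1 - \<alpha> * s)"
  proof -
    have "- ln (1 - \<alpha> * s) \<le> 1 / (1 - \<alpha> * s) - 1"
      using ln_le_minus_one[of "1 / (1 - \<alpha> * s)"] s by (simp add: ln_div)
    also have "\<dots> = \<alpha> * s / (1 - \<alpha> * s)"
      using s by (simp add: field_simps)
    finally have "t \<le> (\<alpha> * s / (1 - \<alpha> * s)) / \<alpha>"
      unfolding t_def using \<alpha> by (intro divide_right_mono) auto
    also have "\<dots> = s * (1 + \<alpha> * s / (1 - \<alpha> * s))"
      using \<alpha> s by (simp add: field_simps)
    finally show ?thesis using s by (simp add: field_simps)
  qed
  finally show ?thesis .
qed

text \<open>
  Where \<open>\<alpha> k > 1/s\<close>, the power \<open>(1 - \<alpha> s)^k\<close> is below \<open>exp (- 1) \<le> 1/2\<close>. So a generating function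
  close to one at \<open>\<alpha> s\<close> leaves little mass there, which is what tightness needs.
\<close>
lemma scaled_law_tail:
  assumes \<alpha>: "0 < \<alpha>" and s: "0 < s" "\<alpha> * s < 1"
  shows "measure (scaled_law Z \<alpha>) {-1<..1/s} \<ge> 1 - 2 * (1 - alt_pgf Z (\<alpha> * s))"
proof -
  have "0 < \<alpha> * s" using assms by simp
  define T where "T = {k. \<alpha> * real k > 1 / s}"
  have le: "(1 - \<alpha> * s) ^ k \<le> 1 - indicator T k / 2" for k
  proof (cases "k \<in> T")
    case True
    have "(1 - \<alpha> * s) ^ k \<le> exp (- (\<alpha> * s)) ^ k"
      using s exp_ge_add_one_self[of "- (\<alpha> * s)"] by (intro power_mono) auto
    also have "\<dots> = exp (- (s * (\<alpha> * real k)))"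
      by (simp add: exp_of_nat_mult[symmetric] mult_ac)
    also have "\<dots> \<le> exp (- 1)"
      using True s by (simp add: T_def field_simps)
    also have "\<dots> \<le> 1 / 2"
      using exp_ge_add_one_self[of 1] by (simp add: exp_minus field_simps)
    finally show ?thesis using True by simp
  next
    case False
    then show ?thesis using s \<open>0 < \<alpha> * s\<close> by (simp add: power_le_one)
  qed
  have "alt_pgf Z (\<alpha> * s) = measure_pmf.expectation Z (\<lambda>k. (1 - \<alpha> * s) ^ k)"
    using s \<open>0 < \<alpha> * s\<close> by (intro alt_pgf_eq_expectation) auto
  also have "\<dots> \<le> measure_pmf.expectation Z (\<lambda>k. 1 - indicator T k / 2 :: real)"
  proof (rule integral_mono[OF _ _ le])
    show "integrable (measure_pmf Z) (\<lambda>k. (1 - \<alpha> * s) ^ k)"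
      using s \<open>0 < \<alpha> * s\<close>
      by (intro measure_pmf.integrable_const_bound[where B = 1] AE_I2) (auto intro: power_le_one)
    show "integrable (measure_pmf Z) (\<lambda>k. 1 - indicator T k / 2 :: real)"
      by (intro measure_pmf.integrable_const_bound[where B = 1] AE_I2) (auto simp: indicator_def)
  qed
  also have "\<dots> = 1 - measure (measure_pmf Z) T / 2"
  proof -
    have "integrable (measure_pmf Z) (\<lambda>k. indicator T k / 2 :: real)"
      by (intro measure_pmf.integrable_const_bound[where B = 1] AE_I2) (auto simp: indicator_def)
    then show ?thesis by simp
  qed
  finally have T: "measure (measure_pmf Z) T \<le> 2 * (1 - alt_pgf Z (\<alpha> * s))" by simp
  have "measure (scaled_law Z \<alpha>) {-1<..1/s} = measure (measure_pmf Z) (- T)"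
  proof -
    have "- T = (\<lambda>k. \<alpha> * real k) -` {-1<..1/s}"
    proof -
      have "- 1 < \<alpha> * real k" for k
        using mult_nonneg_nonneg[of \<alpha> "real k"] \<alpha> by linarith
      then show ?thesis by (auto simp: T_def)
    qed
    then show ?thesis by (simp add: scaled_law_def measure_distr)
  qed
  also have "\<dots> = 1 - measure (measure_pmf Z) T"
    using measure_pmf.prob_compl[of T Z] by (simp add: Compl_eq_Diff_UNIV)
  finally show ?thesis using T by simp
qed

text \<open>
  If \<open>X\<close> is an \<open>\<alpha>\<close>-thinning of \<open>Z\<^sub>\<alpha>\<close>, the generating function of \<open>Z\<^sub>\<alpha>\<close> at \<open>\<alpha> s\<close> is that of \<open>X\<close> at \<open>s\<close>,
  for every \<open>\<alpha>\<close>. Its right continuity at \<open>0\<close> thus gives tightness uniformly in \<open>\<alpha>\<close>, and Helly's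
  selection theorem provides a limit law. The shift by \<open>3\<close> keeps \<open>\<alpha> s < 1\<close> for all \<open>s \<le> 2\<close>.
\<close>
theorem laplace_if_thinned_arbitrarily:
  assumes thin: "\<And>n. X \<in> thinned (1 / (real n + 3))"
  obtains M :: "real measure" where "nonneg_rv M abs" "\<And>s. s \<in> {0..2} \<Longrightarrow> alt_pgf X s = laplace M abs s"
proof -
  define \<alpha> where "\<alpha> n = 1 / (real n + 3)" for n
  have \<alpha>: "0 < \<alpha> n" "\<alpha> n \<le> 1" for n by (auto simp: \<alpha>_def)
  have \<alpha>_s: "\<alpha> n * s < 1" if "s \<le> 2" for n s
    using that by (simp add: \<alpha>_def field_simps)
  have "\<forall>n. \<exists>Z. X = thin (\<alpha> n) Z"
    using thin by (simp add: thinned_def \<alpha>_def)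
  then obtain Z where Z: "\<And>n. X = thin (\<alpha> n) (Z n)" by metis
  have pgf_Z: "alt_pgf (Z n) (\<alpha> n * s) = alt_pgf X s" if "s \<in> {0..2}" for n s
    using alt_pgf_thin[OF \<alpha>[of n] that, of "Z n"] Z[of n] by simp
  define \<mu> where "\<mu> n = scaled_law (Z n) (\<alpha> n)" for n
  have tight: "tight \<mu>"
    unfolding tight_def
  proof (intro conjI allI impI)
    show "real_distribution (\<mu> n)" for n
      unfolding \<mu>_def by (rule real_distribution_scaled_law)
    fix \<epsilon> :: real assume "0 < \<epsilon>"
    have "((\<lambda>t. alt_pgf X (t / 1)) \<longlongrightarrow> 1) (at_right 0)"
      using tendsto_alt_pgf_at_right_0[of 1 X] by (simp add: alt_pgf_0)
    then have "eventually (\<lambda>s. 1 - \<epsilon> / 2 < alt_pgf X (s / 1)) (at_right 0)"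
      by (rule order_tendstoD) (use \<open>0 < \<epsilon>\<close> in simp)
    moreover have "eventually (\<lambda>s. s \<in> {0<..<2}) (at_right (0 :: real))"
      by (rule eventually_at_right_real) simp
    ultimately have "eventually (\<lambda>s. 1 - \<epsilon> / 2 < alt_pgf X s \<and> s \<in> {0<..<2}) (at_right (0 :: real))"
      by eventually_elim simp
    then obtain s where s: "1 - \<epsilon> / 2 < alt_pgf X s" "0 < s" "s < 2"
      by (auto dest!: eventually_happens)
    have "measure (\<mu> n) {-1<..1/s} > 1 - \<epsilon>" for n
    proof -
      have eq: "alt_pgf (Z n) (\<alpha> n * s) = alt_pgf X s"
        using s by (intro pgf_Z) auto
      have "1 - \<epsilon> < 1 - 2 * (1 - alt_pgf (Z n) (\<alpha> n * s))"
        unfolding eq using s(1) by (simp add: field_simps)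
      also have "\<dots> \<le> measure (\<mu> n) {-1<..1/s}"
        unfolding \<mu>_def using s by (intro scaled_law_tail \<alpha> \<alpha>_s) auto
      finally show ?thesis .
    qed
    moreover have "-1 < 1 / s"
      by (rule less_trans[of _ 0]) (use s in auto)
    ultimately show "\<exists>a b. a < b \<and> (\<forall>n. measure (\<mu> n) {a<..b} > 1 - \<epsilon>)"
      by (intro exI[of _ "-1"] exI[of _ "1/s"] conjI allI)
  qed
  then obtain r M where r: "strict_mono (r :: nat \<Rightarrow> nat)" and M: "real_distribution M"
    and conv: "weak_conv_m (\<mu> \<circ> r) M"
    using tight_imp_convergent_subsubsequence[OF tight strict_mono_id] by auto
  interpret M: real_distribution M by (rule M)
  have rv: "nonneg_rv M abs"
    using M.prob_space_axioms by (simp add: nonneg_rv_def)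
  have eq: "alt_pgf X s = laplace M abs s" if s: "0 < s" "s \<le> 2" for s
  proof -
    have "(\<lambda>n. \<integral>y. exp (- (s * \<bar>y\<bar>)) \<partial>(\<mu> \<circ> r) n) \<longlonglongrightarrow> (\<integral>y. exp (- (s * \<bar>y\<bar>)) \<partial>M)"
    proof (rule weak_conv_imp_integral_bdd_continuous_conv[OF _ M conv, where B = 1])
      show "real_distribution ((\<mu> \<circ> r) n)" for n
        by (simp add: \<mu>_def real_distribution_scaled_law)
    qed (use s in \<open>auto intro!: continuous_intros\<close>)
    moreover have "(\<lambda>n. \<integral>y. exp (- (s * \<bar>y\<bar>)) \<partial>(\<mu> \<circ> r) n) \<longlonglongrightarrow> alt_pgf X s"
    proof -
      have "(\<lambda>n. 1 / (real n + 3)) \<longlonglongrightarrow> 0"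
        using LIMSEQ_ignore_initial_segment[OF lim_1_over_n, of 3] by (simp add: add.commute)
      then have "\<alpha> \<longlonglongrightarrow> 0" by (simp add: \<alpha>_def[abs_def])
      then have "(\<lambda>n. \<alpha> n * s / (1 - \<alpha> n * s)) \<longlonglongrightarrow> 0 * s / (1 - 0 * s)"
        by (intro tendsto_intros) auto
      then have error: "(\<lambda>n. \<alpha> n * s / (1 - \<alpha> n * s)) \<longlonglongrightarrow> 0" by simp
      have bound: "norm ((\<integral>y. exp (- (s * \<bar>y\<bar>)) \<partial>\<mu> n) - alt_pgf X s) \<le> \<alpha> n * s / (1 - \<alpha> n * s)" for n
      proof -
        have eq: "alt_pgf (Z n) (\<alpha> n * s) = alt_pgf X s"
          using s by (intro pgf_Z) auto
        have "norm ((\<integral>y. exp (- (s * \<bar>y\<bar>)) \<partial>\<mu> n) - alt_pgf (Z n) (\<alpha> n * s)) \<le> \<alpha> n * s / (1 - \<alpha> n * s)"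
          unfolding \<mu>_def real_norm_def by (rule alt_pgf_near_laplace[OF \<alpha>(1) s(1) \<alpha>_s[OF s(2)]])
        then show ?thesis by (simp only: eq)
      qed
      have "(\<lambda>n. (\<integral>y. exp (- (s * \<bar>y\<bar>)) \<partial>\<mu> n) - alt_pgf X s) \<longlonglongrightarrow> 0"
        by (rule Lim_null_comparison[OF _ error]) (rule always_eventually[OF allI[OF bound]])
      then have "(\<lambda>n. \<integral>y. exp (- (s * \<bar>y\<bar>)) \<partial>\<mu> n) \<longlonglongrightarrow> alt_pgf X s"
        by (simp add: LIM_zero_iff)
      from LIMSEQ_subseq_LIMSEQ[OF this r] show ?thesis by (simp add: o_def)
    qed
    ultimately have "(\<integral>y. exp (- (s * \<bar>y\<bar>)) \<partial>M) = alt_pgf X s"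
      by (rule LIMSEQ_unique)
    then show ?thesis by (simp add: laplace_def)
  qed
  have "alt_pgf X s = laplace M abs s" if "s \<in> {0..2}" for s
  proof (cases "s = 0")
    case True
    then show ?thesis using M.prob_space by (simp add: alt_pgf_0 laplace_def)
  qed (use eq that in auto)
  then show ?thesis using that rv by blast
qed

lemma completely_monotone_on_subset:
  "completely_monotone_on I f \<Longrightarrow> J \<subseteq> I \<Longrightarrow> completely_monotone_on J f"
  by (auto simp: completely_monotone_on_def)

lemma mixed_poisson_if_completely_monotone:
  assumes cm: "completely_monotone_on {0<..} f" and lim: "(f \<longlongrightarrow> f 0) (at_right 0)"
    and S: "S \<subseteq> {0<..<2}" "x \<in> S" "x islimpt S"
    and eq: "\<And>s. s \<in> S \<Longrightarrow> f s = alt_pgf X s"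
  shows "mixed_poisson X"
proof -
  have thin: "X \<in> thinned (1 / (real n + 3))" for n
  proof (rule thinned_if_completely_monotone[OF _ _ _ lim _ S(2,3) eq])
    show "completely_monotone_on {0<..<1 / (1 / (real n + 3))} f"
      by (rule completely_monotone_on_subset[OF cm]) auto
  qed (use S in auto)
  obtain M :: "real measure" where "nonneg_rv M abs" "\<And>s. s \<in> {0..2} \<Longrightarrow> alt_pgf X s = laplace M abs s"
    using laplace_if_thinned_arbitrarily[OF thin] by blast
  then show ?thesis unfolding mixed_poisson_iff_laplace by blast
qed

lemma completely_monotone_if_mixed_poisson:
  assumes "mixed_poisson X"
  obtains f where "completely_monotone_on {0<..} f" "(f \<longlongrightarrow> f 0) (at_right 0)"
    "\<And>s. s \<in> {0..2} \<Longrightarrow> f s = alt_pgf X s"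
proof -
  obtain M :: "real measure" and Y where "nonneg_rv M Y" "\<forall>s\<in>{0..2}. alt_pgf X s = laplace M Y s"
    using assms unfolding mixed_poisson_iff_laplace by blast
  then show ?thesis
    by (intro that[of "laplace M Y"] completely_monotone_laplace tendsto_laplace_at_right_0) simp_all
qed

lemma open_interval_contains_limit_point:
  fixes b :: real
  assumes "0 < b"
  shows "\<exists>x\<in>{0<..<b}. x islimpt {0<..<b}"
  using assms by (intro bexI[of _ "b / 2"] interior_limit_point) auto

theorem theorem1:
  fixes X :: "nat pmf" and \<alpha> :: real
  assumes "0 < \<alpha>" and "\<alpha> < 1"
  shows
    "((\<exists>(f :: real \<Rightarrow> real) S.
          completely_monotone_on {0<..<1/\<alpha>} f \<and> (f \<longlongrightarrow> f 0) (at_right 0) \<and>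
          S \<subseteq> {0<..<min (1/\<alpha>) 2} \<and> (\<exists>x\<in>S. x islimpt S) \<and>
          (\<forall>s\<in>S. f s = alt_pgf X s))
        \<longleftrightarrow> X \<in> thinned \<alpha>)
     \<and> (X \<in> thinned \<alpha> \<longrightarrow> (\<exists>Z. \<forall>s\<in>{0..2}. alt_pgf X s = alt_pgf Z (\<alpha> * s)))
     \<and> ((\<exists>(f :: real \<Rightarrow> real) S.
          completely_monotone_on {0<..} f \<and> (f \<longlongrightarrow> f 0) (at_right 0) \<and>
          S \<subseteq> {0<..<2} \<and> (\<exists>x\<in>S. x islimpt S) \<and>
          (\<forall>s\<in>S. f s = alt_pgf X s))
        \<longleftrightarrow> mixed_poisson X)
     \<and> (mixed_poisson X \<longleftrightarrow>
          (\<exists>(M :: real measure) Y. nonneg_rv M Y \<and> (\<forall>s\<in>{0..2}. alt_pgf X s = laplace M Y s)))"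
    (is "(?thinned_cm \<longleftrightarrow> _) \<and> ?pgf \<and> (?mixed_cm \<longleftrightarrow> _) \<and> ?laplace")
proof -
  have \<alpha>: "0 < \<alpha>" "\<alpha> \<le> 1" using assms by auto
  have thinned: "?thinned_cm \<longleftrightarrow> X \<in> thinned \<alpha>"
  proof
    assume ?thinned_cm
    then obtain f S x where f: "completely_monotone_on {0<..<1/\<alpha>} f" "(f \<longlongrightarrow> f 0) (at_right 0)"
      "S \<subseteq> {0<..<min (1/\<alpha>) 2}" "x \<in> S" "x islimpt S"
      and eq: "\<forall>s\<in>S. f s = alt_pgf X s"
      by blast
    show "X \<in> thinned \<alpha>"
      by (rule thinned_if_completely_monotone[OF \<alpha> f]) (rule eq[rule_format])
  next
    assume "X \<in> thinned \<alpha>"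
    then obtain f where f: "completely_monotone_on {0<..<1/\<alpha>} f" "(f \<longlongrightarrow> f 0) (at_right 0)"
      "\<And>s. s \<in> {0..2} \<Longrightarrow> f s = alt_pgf X s"
      using completely_monotone_if_thinned[OF \<alpha>] by blast
    have "\<exists>x\<in>{0<..<min (1/\<alpha>) 2}. x islimpt {0<..<min (1/\<alpha>) 2}"
      using \<alpha> by (intro open_interval_contains_limit_point) simp
    with f show ?thinned_cm
      by (intro exI[of _ f] exI[of _ "{0<..<min (1/\<alpha>) 2}"]) auto
  qed
  have pgf: ?pgf
    using alt_pgf_thin[OF \<alpha>] by (auto simp: thinned_def)
  have mixed: "?mixed_cm \<longleftrightarrow> mixed_poisson X"
  proof
    assume ?mixed_cm
    then obtain f S x where f: "completely_monotone_on {0<..} f" "(f \<longlongrightarrow> f 0) (at_right 0)"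
      "S \<subseteq> {0<..<2}" "x \<in> S" "x islimpt S"
      and eq: "\<forall>s\<in>S. f s = alt_pgf X s"
      by blast
    show "mixed_poisson X"
      by (rule mixed_poisson_if_completely_monotone[OF f]) (rule eq[rule_format])
  next
    assume "mixed_poisson X"
    then obtain f where f: "completely_monotone_on {0<..} f" "(f \<longlongrightarrow> f 0) (at_right 0)"
      "\<And>s. s \<in> {0..2} \<Longrightarrow> f s = alt_pgf X s"
      using completely_monotone_if_mixed_poisson by blast
    then show ?mixed_cm
      using open_interval_contains_limit_point[of 2]
      by (intro exI[of _ f] exI[of _ "{0<..<2}"]) auto
  qed
  show ?thesis
    by (intro conjI thinned pgf mixed mixed_poisson_iff_laplace)
qed

end
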